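(* Let $n\ge 2$ and let $p_{i,j}=p_{j,i}\in\{2,3,\dots\}\cup\{\infty\}$ for $1\le i<j\le n-1$ and let $p_{1,n}\in\{2,3,\dots\}\cup\{\infty\}$. Let $G$ be the Shephard group with generating set $S=\{a_0,a_1,\dots,a_{n-1}\}$ and relations: $a_0^2=1$; $(a_0a_1)_{2p_{1,n}}=(a_1a_0)_{2p_{1,n}}$ if $p_{1,n}\ne\infty$; $a_0a_i=a_ia_0$ for $2\le i\le n-1$; and $(a_ia_j)_{p_{i,j}}=(a_ja_i)_{p_{i,j}}$ for $1\le i<j\le n-1$ with $p_{i,j}\neq\infty$ (the generators $a_1,\dots,a_{n-1}$ have no order relation). Then, for all $J,K,L\subseteq S$: (a) $\langle J\rangle\cap\langle K\rangle=\langle J\cap K\rangle$; (b) $\langle J\rangle\langle K\rangle\cap\langle J\rangle\langle L\rangle=\langle J\rangle(\langle K\rangle\cap\langle L\rangle)$; (c) the simplicial complex $\mathcal K(G,(G_i)_{i\in I})$ is a flag complex, where $I=\{0,\dots,n-1\}$ and $G_i=\langle a_j\mid j\in I\setminus\{i\}\rangle$.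
   Context: $(ab)_m$ denotes the alternating word $aba\cdots$ with $m$ factors. Products such as $\langle J\rangle\langle K\rangle$ are sets of products of elements. The coset complex $\mathcal K(G,(G_i)_{i\in I})$ is the abstract simplicial complex with vertices the left cosets $gG_i$, $g\in G$, $i\in I$ (cosets of different types $i$ are different vertices), a set $\{g_1G_{i_1},\dots,g_mG_{i_m}\}$ of vertices being a simplex iff $g_1G_{i_1}\cap\dots\cap g_mG_{i_m}\neq\emptyset$. A simplicial complex is a flag complex if every set of vertices that are pairwise joined by edges is a simplex. *)

theory Defs
  imports "HOL-Algebra.Coset" "HOL-Algebra.Generated_Groups" "HOL-Library.Extended_Nat"
begin

section \<open>Groups given by generators and relations\<close>

text \<open>A letter \<open>(s, True)\<close> stands for the generator \<open>s\<close> and \<open>(s, False)\<close> for its formal inverse.\<close>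

type_synonym 'a gword = "('a \<times> bool) list"

definition gwords :: "'a set \<Rightarrow> 'a gword set" where
  "gwords S = lists (S \<times> UNIV)"

text \<open>The least congruence on the words over \<open>S\<close> that contains free cancellation and
  identifies the two sides of every relation \<open>(l, r) \<in> R\<close>.\<close>

inductive_set pres_cong :: "'a set \<Rightarrow> ('a gword \<times> 'a gword) set \<Rightarrow> ('a gword \<times> 'a gword) set"
  for S R where
  refl: "w \<in> gwords S \<Longrightarrow> (w, w) \<in> pres_cong S R"
| sym: "(v, w) \<in> pres_cong S R \<Longrightarrow> (w, v) \<in> pres_cong S R"
| trans: "(u, v) \<in> pres_cong S R \<Longrightarrow> (v, w) \<in> pres_cong S R \<Longrightarrow> (u, w) \<in> pres_cong S R"
| cancel: "u \<in> gwords S \<Longrightarrow> v \<in> gwords S \<Longrightarrow> s \<in> S \<Longrightarrow>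
    (u @ [(s, e), (s, \<not> e)] @ v, u @ v) \<in> pres_cong S R"
| rel: "u \<in> gwords S \<Longrightarrow> v \<in> gwords S \<Longrightarrow> l \<in> gwords S \<Longrightarrow> r \<in> gwords S \<Longrightarrow> (l, r) \<in> R \<Longrightarrow>
    (u @ l @ v, u @ r @ v) \<in> pres_cong S R"

definition presented_group ::
    "'a set \<Rightarrow> ('a gword \<times> 'a gword) set \<Rightarrow> 'a gword set monoid" where
  "presented_group S R =
    \<lparr>carrier = gwords S // pres_cong S R,
     mult = (\<lambda>A B. \<Union>x\<in>A. \<Union>y\<in>B. pres_cong S R `` {x @ y}),
     one = pres_cong S R `` {[]}\<rparr>"

definition pres_gen :: "'a set \<Rightarrow> ('a gword \<times> 'a gword) set \<Rightarrow> 'a \<Rightarrow> 'a gword set" where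
  "pres_gen S R s = pres_cong S R `` {[(s, True)]}"

lemma gwords_append [simp]: "u @ v \<in> gwords S \<longleftrightarrow> u \<in> gwords S \<and> v \<in> gwords S"
  by (simp add: gwords_def)

lemma gwords_Nil [simp]: "[] \<in> gwords S"
  by (simp add: gwords_def)

lemma gwords_Cons [simp]: "x # w \<in> gwords S \<longleftrightarrow> fst x \<in> S \<and> w \<in> gwords S"
  by (cases x) (auto simp: gwords_def)

lemma pres_cong_gwords: "(v, w) \<in> pres_cong S R \<Longrightarrow> v \<in> gwords S \<and> w \<in> gwords S"
  by (induction rule: pres_cong.induct) auto

lemma equiv_pres_cong: "equiv (gwords S) (pres_cong S R)"
  by (rule equivI)
    (auto intro!: refl_onI symI transI dest: pres_cong_gwords
          intro: pres_cong.refl pres_cong.sym pres_cong.trans)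

lemma pres_cong_context:
  assumes "(v, w) \<in> pres_cong S R" "x \<in> gwords S" "y \<in> gwords S"
  shows "(x @ v @ y, x @ w @ y) \<in> pres_cong S R"
  using assms
proof (induction rule: pres_cong.induct)
  case (cancel u v s e)
  then show ?case using pres_cong.cancel[of "x @ u" S "v @ y" s e R] by simp
next
  case (rel u v l r)
  then show ?case using pres_cong.rel[of "x @ u" S "v @ y" l r R] by simp
qed (auto intro: pres_cong.refl pres_cong.sym pres_cong.trans)

lemma pres_cong_append:
  assumes "(v, v') \<in> pres_cong S R" "(w, w') \<in> pres_cong S R"
  shows "(v @ w, v' @ w') \<in> pres_cong S R"
proof (rule pres_cong.trans)
  show "(v @ w, v' @ w) \<in> pres_cong S R"
    using pres_cong_context[of v v' S R "[]" w] assms pres_cong_gwords by fastforce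
  show "(v' @ w, v' @ w') \<in> pres_cong S R"
    using pres_cong_context[of w w' S R v' "[]"] assms pres_cong_gwords by fastforce
qed

lemma presented_group_mult:
  assumes "v \<in> gwords S" "w \<in> gwords S"
  shows "pres_cong S R `` {v} \<otimes>\<^bsub>presented_group S R\<^esub> pres_cong S R `` {w} = pres_cong S R `` {v @ w}"
proof -
  have "congruent2 (pres_cong S R) (pres_cong S R) (\<lambda>x y. pres_cong S R `` {x @ y})"
    by (intro congruent2I' equiv_class_eq[OF equiv_pres_cong] pres_cong_append)
  from UN_equiv_class2[OF equiv_pres_cong equiv_pres_cong this assms]
  show ?thesis by (simp add: presented_group_def)
qed

lemma pres_cong_inverse:
  "w \<in> gwords S \<Longrightarrow> (rev (map (\<lambda>(s, e). (s, \<not> e)) w) @ w, []) \<in> pres_cong S R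
     \<and> rev (map (\<lambda>(s, e). (s, \<not> e)) w) \<in> gwords S"
proof (induction w)
  case Nil
  then show ?case by (simp add: pres_cong.refl)
next
  case (Cons x w)
  obtain s e where x: "x = (s, e)" by (cases x)
  let ?w = "rev (map (\<lambda>(s, e). (s, \<not> e)) w)"
  have "(?w @ [(s, \<not> e), (s, \<not> \<not> e)] @ w, ?w @ w) \<in> pres_cong S R"
    using Cons x by (intro pres_cong.cancel) auto
  with Cons x show ?case by (auto intro: pres_cong.trans)
qed

theorem group_presented_group: "group (presented_group S R)"
proof (rule groupI)
  let ?G = "presented_group S R" and ?c = "\<lambda>w. pres_cong S R `` {w}"
  have carr: "carrier ?G = ?c ` gwords S"
    by (auto simp: presented_group_def quotient_def)
  have one: "\<one>\<^bsub>?G\<^esub> = ?c []" by (simp add: presented_group_def)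
  show "\<one>\<^bsub>?G\<^esub> \<in> carrier ?G" by (auto simp: carr one)
  show "x \<otimes>\<^bsub>?G\<^esub> y \<in> carrier ?G" if "x \<in> carrier ?G" "y \<in> carrier ?G" for x y
    using that by (auto simp: carr presented_group_mult)
  show "x \<otimes>\<^bsub>?G\<^esub> y \<otimes>\<^bsub>?G\<^esub> z = x \<otimes>\<^bsub>?G\<^esub> (y \<otimes>\<^bsub>?G\<^esub> z)"
    if "x \<in> carrier ?G" "y \<in> carrier ?G" "z \<in> carrier ?G" for x y z
    using that by (auto simp: carr presented_group_mult)
  show "\<one>\<^bsub>?G\<^esub> \<otimes>\<^bsub>?G\<^esub> x = x" if "x \<in> carrier ?G" for x
    using that by (auto simp: carr one presented_group_mult)
  show "\<exists>y\<in>carrier ?G. y \<otimes>\<^bsub>?G\<^esub> x = \<one>\<^bsub>?G\<^esub>" if "x \<in> carrier ?G" for x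
  proof -
    from that obtain w where w: "w \<in> gwords S" "x = ?c w" by (auto simp: carr)
    let ?v = "rev (map (\<lambda>(s, e). (s, \<not> e)) w)"
    have "?c ?v \<otimes>\<^bsub>?G\<^esub> x = \<one>\<^bsub>?G\<^esub>" "?c ?v \<in> carrier ?G"
      using pres_cong_inverse[OF w(1), of R] w
      by (auto simp: carr one presented_group_mult intro!: equiv_class_eq[OF equiv_pres_cong])
    then show ?thesis by blast
  qed
qed

section \<open>The Shephard group\<close>

text \<open>The alternating word \<open>aba\<cdots>\<close> with \<open>m\<close> factors.\<close>

definition alt_word :: "'a \<Rightarrow> 'a \<Rightarrow> nat \<Rightarrow> 'a gword" where
  "alt_word a b m = map (\<lambda>k. (if even k then a else b, True)) [0..<m]"

text \<open>The generator \<open>a\<^sub>i\<close> is encoded by its index \<open>i\<close>. The label \<open>p 1 n\<close> belongs to the edge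
  between \<open>a\<^sub>0\<close> and \<open>a\<^sub>1\<close>; it never clashes with the labels \<open>p i j\<close>, where \<open>j \<le> n - 1\<close>.\<close>

definition shephard_rels :: "nat \<Rightarrow> (nat \<Rightarrow> nat \<Rightarrow> enat) \<Rightarrow> (nat gword \<times> nat gword) set" where
  "shephard_rels n p =
     {(alt_word 0 0 2, [])}
   \<union> {(alt_word 0 1 (2 * m), alt_word 1 0 (2 * m)) | m. p 1 n = enat m}
   \<union> {(alt_word 0 i 2, alt_word i 0 2) | i. 2 \<le> i \<and> i \<le> n - 1}
   \<union> {(alt_word i j m, alt_word j i m) | i j m. 1 \<le> i \<and> i < j \<and> j \<le> n - 1 \<and> p i j = enat m}"

definition shephard_group :: "nat \<Rightarrow> (nat \<Rightarrow> nat \<Rightarrow> enat) \<Rightarrow> nat gword set monoid" where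
  "shephard_group n p = presented_group {0..<n} (shephard_rels n p)"

definition shephard_gen :: "nat \<Rightarrow> (nat \<Rightarrow> nat \<Rightarrow> enat) \<Rightarrow> nat \<Rightarrow> nat gword set" where
  "shephard_gen n p i = pres_gen {0..<n} (shephard_rels n p) i"

text \<open>The subgroup generated by the \<open>a\<^sub>i\<close> with \<open>i \<in> J\<close>; a subset of the generating set is
  given by the set \<open>J\<close> of its indices.\<close>

definition shephard_sub :: "nat \<Rightarrow> (nat \<Rightarrow> nat \<Rightarrow> enat) \<Rightarrow> nat set \<Rightarrow> nat gword set set" where
  "shephard_sub n p J = generate (shephard_group n p) (shephard_gen n p ` J)"

section \<open>Simplicial complexes\<close>

text \<open>An abstract simplicial complex is given by its set of (nonempty) simplices; its vertex set
  is the union of these.\<close>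

definition simplicial_complex :: "'v set set \<Rightarrow> bool" where
  "simplicial_complex \<K> \<longleftrightarrow>
     (\<forall>\<sigma>\<in>\<K>. finite \<sigma> \<and> \<sigma> \<noteq> {} \<and> (\<forall>\<tau>. \<tau> \<subseteq> \<sigma> \<and> \<tau> \<noteq> {} \<longrightarrow> \<tau> \<in> \<K>))"

definition flag_complex :: "'v set set \<Rightarrow> bool" where
  "flag_complex \<K> \<longleftrightarrow> simplicial_complex \<K> \<and>
     (\<forall>\<sigma>. \<sigma> \<subseteq> \<Union>\<K> \<and> \<sigma> \<noteq> {} \<and> (\<forall>v\<in>\<sigma>. \<forall>w\<in>\<sigma>. v \<noteq> w \<longrightarrow> {v, w} \<in> \<K>) \<longrightarrow> \<sigma> \<in> \<K>)"

text \<open>The vertex \<open>g H\<^sub>i\<close> is tagged with its type \<open>i\<close>, so that cosets of different types are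
  different vertices even if they agree as sets.\<close>

definition coset_vertices :: "('g, 'm) monoid_scheme \<Rightarrow> 'i set \<Rightarrow> ('i \<Rightarrow> 'g set) \<Rightarrow> ('i \<times> 'g set) set" where
  "coset_vertices G I H = {(i, g <#\<^bsub>G\<^esub> H i) | i g. i \<in> I \<and> g \<in> carrier G}"

definition coset_complex :: "('g, 'm) monoid_scheme \<Rightarrow> 'i set \<Rightarrow> ('i \<Rightarrow> 'g set) \<Rightarrow> ('i \<times> 'g set) set set" where
  "coset_complex G I H =
     {\<sigma>. finite \<sigma> \<and> \<sigma> \<noteq> {} \<and> \<sigma> \<subseteq> coset_vertices G I H \<and> (\<Inter>v\<in>\<sigma>. snd v) \<noteq> {}}"

end

theory Submission
  imports Defs Complex_Main
begin

text \<open>Let the generators act on a real vector space by the reflections of the Tits form of the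
  associated Coxeter matrix. Fix a set \<open>X\<close> of generators and read a word letter by letter, keeping as
  a state a linear map \<open>g\<close>, initially the identity, that maps the simple roots of \<open>X\<close> to positive
  vectors: it is the inverse of a shortest representative of a right coset of the Coxeter group of
  \<open>X\<close>. If \<open>g\<close> maps the simple root of some \<open>x\<close> in \<open>X\<close> to that of the letter \<open>s\<close>, the letter \<open>x\<close> is
  written and the state is kept; otherwise nothing is written and \<open>g\<close> is followed by the reflection
  in \<open>s\<close>. The word written depends, as a group element, only on the group element that was read.
  For a braid relation this is dihedral geometry, and for \<open>s\<^sup>2 = 1\<close> it holds because no edge with an
  odd label leaves the set of involutive generators, so that \<open>x\<close> is an involution as well. Hence \<open>\<langle>X\<rangle>\<close> is a retract of the group by a map that
  commutes with left multiplication by \<open>\<langle>X\<rangle>\<close> and sends \<open>\<langle>K\<rangle>\<close> into \<open>\<langle>X \<inter> K\<rangle>\<close>. Such retractions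
  yield (a), (b) and a Helly property for cosets, which is (c).\<close>

section \<open>The Tits representation\<close>

locale coxeter_form =
  fixes S :: "'a set" and m :: "'a \<Rightarrow> 'a \<Rightarrow> enat"
  assumes finite_S: "finite S"
    and m_sym: "s \<in> S \<Longrightarrow> t \<in> S \<Longrightarrow> m s t = m t s"
    and m_ge_2: "s \<in> S \<Longrightarrow> t \<in> S \<Longrightarrow> s \<noteq> t \<Longrightarrow> 2 \<le> m s t"
begin

text \<open>The value at infinity is the limit of \<open>cos (pi / k)\<close>, so that an infinite
  label gives the Gram entry -1.\<close>

definition angle_cos :: "enat \<Rightarrow> real" where
  "angle_cos k = (case k of enat k \<Rightarrow> cos (pi / k) | \<infinity> \<Rightarrow> 1)"

definition gram :: "'a \<Rightarrow> 'a \<Rightarrow> real" where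
  "gram s t = (if s = t then 1 else - angle_cos (m s t))"

definition simple_root :: "'a \<Rightarrow> 'a \<Rightarrow> real"  (\<open>\<alpha>\<close>) where
  "\<alpha> s = (\<lambda>i. if i = s then 1 else 0)"

definition pairing :: "'a \<Rightarrow> ('a \<Rightarrow> real) \<Rightarrow> real" where
  "pairing s v = (\<Sum>j\<in>S. gram s j * v j)"

definition form :: "('a \<Rightarrow> real) \<Rightarrow> ('a \<Rightarrow> real) \<Rightarrow> real" where
  "form u v = (\<Sum>i\<in>S. u i * pairing i v)"

definition reflect :: "'a \<Rightarrow> ('a \<Rightarrow> real) \<Rightarrow> 'a \<Rightarrow> real" where
  "reflect s v = (\<lambda>i. v i - 2 * pairing s v * \<alpha> s i)"

primrec act :: "'a list \<Rightarrow> ('a \<Rightarrow> real) \<Rightarrow> 'a \<Rightarrow> real" where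
  "act [] = id"
| "act (s # w) = reflect s \<circ> act w"

lemma gram_sym: "s \<in> S \<Longrightarrow> t \<in> S \<Longrightarrow> gram s t = gram t s"
  by (auto simp: gram_def m_sym)

lemma gram_self [simp]: "gram s s = 1"
  by (simp add: gram_def)

lemma simple_root_inject [simp]: "\<alpha> s = \<alpha> t \<longleftrightarrow> s = t"
  by (metis simple_root_def zero_neq_one)

lemma simple_root_same [simp]: "\<alpha> s s = 1"
  by (simp add: simple_root_def)

lemma simple_root_other [simp]: "i \<noteq> s \<Longrightarrow> \<alpha> s i = 0"
  by (simp add: simple_root_def)

lemma pairing_lincomb: "pairing s (\<lambda>i. a * u i + b * v i) = a * pairing s u + b * pairing s v"
  by (simp add: pairing_def sum_distrib_left distrib_left sum.distrib algebra_simps)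

lemma pairing_simple_root: "t \<in> S \<Longrightarrow> pairing s (\<alpha> t) = gram s t"
  by (simp add: pairing_def simple_root_def finite_S if_distrib[of "(*) _"] cong: if_cong)

lemma form_simple_root_left: "s \<in> S \<Longrightarrow> form (\<alpha> s) v = pairing s v"
  by (simp add: form_def simple_root_def finite_S if_distrib[of "\<lambda>x. x * _"] cong: if_cong)

lemma form_lincomb_left: "form (\<lambda>i. a * u i + b * v i) w = a * form u w + b * form v w"
  by (simp add: form_def sum_distrib_left distrib_left sum.distrib algebra_simps)

lemma form_sym: "form u v = form v u"
proof -
  have "form u v = (\<Sum>i\<in>S. \<Sum>j\<in>S. u i * gram i j * v j)"
    by (simp add: form_def pairing_def sum_distrib_left mult.assoc)
  also have "\<dots> = (\<Sum>j\<in>S. \<Sum>i\<in>S. v j * gram j i * u i)"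
    by (subst sum.swap) (auto intro!: sum.cong simp: gram_sym)
  also have "\<dots> = form v u"
    by (simp add: form_def pairing_def sum_distrib_left mult.assoc)
  finally show ?thesis .
qed

lemma reflect_altdef: "reflect s v = (\<lambda>i. 1 * v i + (- 2 * pairing s v) * \<alpha> s i)"
  by (simp add: reflect_def)

lemma reflect_lincomb: "reflect s (\<lambda>i. a * u i + b * v i) = (\<lambda>i. a * reflect s u i + b * reflect s v i)"
  unfolding reflect_def pairing_lincomb by (auto simp: algebra_simps)

lemma reflect_simple_root: "t \<in> S \<Longrightarrow> reflect s (\<alpha> t) = (\<lambda>i. \<alpha> t i - 2 * gram s t * \<alpha> s i)"
  by (simp add: reflect_def pairing_simple_root)

lemma reflect_simple_root_self: "s \<in> S \<Longrightarrow> reflect s (\<alpha> s) = (\<lambda>i. - \<alpha> s i)"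
  by (simp add: reflect_simple_root)

lemma reflect_reflect: "s \<in> S \<Longrightarrow> reflect s (reflect s v) = v"
proof -
  assume "s \<in> S"
  then have "pairing s (reflect s v) = - pairing s v"
    unfolding reflect_altdef pairing_lincomb by (simp add: pairing_simple_root)
  then show ?thesis
    by (simp add: reflect_def[of s "reflect s v"]) (simp add: reflect_def)
qed

lemma reflect_comp_reflect: "s \<in> S \<Longrightarrow> reflect s \<circ> reflect s = id"
  by (auto simp: reflect_reflect)

lemma form_reflect:
  assumes "s \<in> S" shows "form (reflect s u) (reflect s v) = form u v"
proof -
  have *: "form (reflect s x) y = form x y - 2 * pairing s x * pairing s y" for x y
    unfolding reflect_altdef form_lincomb_left using assms by (simp add: form_simple_root_left)
  have "pairing s (reflect s v) = - pairing s v"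
    unfolding reflect_altdef pairing_lincomb using assms by (simp add: pairing_simple_root)
  then show ?thesis
    by (simp add: * form_sym[of u "reflect s v"] form_sym[of v u])
qed

lemma act_append: "act (u @ v) = act u \<circ> act v"
  by (induction u) (simp_all add: o_assoc)

lemma act_lincomb: "act w (\<lambda>i. a * u i + b * v i) = (\<lambda>i. a * act w u i + b * act w v i)"
  by (induction w) (simp_all add: reflect_lincomb)

lemma act_scale: "act w (\<lambda>i. a * u i) = (\<lambda>i. a * act w u i)"
  using act_lincomb[of w a u 0 u] by simp

lemma form_act: "w \<in> lists S \<Longrightarrow> form (act w u) (act w v) = form u v"
  by (induction w) (auto simp: form_reflect)

lemma act_rev: "w \<in> lists S \<Longrightarrow> act (rev w) (act w v) = v"
  by (induction w) (auto simp: act_append reflect_reflect)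

lemma act_inject: "w \<in> lists S \<Longrightarrow> act w u = act w v \<longleftrightarrow> u = v"
  by (metis act_rev)

lemma reflect_act_eq_act_reflect:
  assumes "w \<in> lists S" "s \<in> S" "x \<in> S" "act w (\<alpha> x) = \<alpha> s"
  shows "reflect s \<circ> act w = act w \<circ> reflect x"
proof
  fix v
  have "pairing s (act w v) = pairing x v"
    using assms form_act[of w "\<alpha> x" v] by (simp add: form_simple_root_left)
  moreover have "act w (reflect x v) = (\<lambda>i. act w v i - 2 * pairing x v * \<alpha> s i)"
    unfolding reflect_altdef act_lincomb by (simp add: assms)
  ultimately show "(reflect s \<circ> act w) v = (act w \<circ> reflect x) v"
    by (simp add: reflect_def)
qed

text \<open>Each reflection changes only the coordinate of its own letter. This later confines the
  written letters to the letters that were read.\<close>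

lemma act_outside: "i \<notin> set w \<Longrightarrow> act w v i = v i"
  by (induction w) (auto simp: reflect_def simple_root_def)

section \<open>Alternating words and dihedral roots\<close>

primrec alts :: "nat \<Rightarrow> 'a \<Rightarrow> 'a \<Rightarrow> 'a list" where
  "alts 0 a b = []"
| "alts (Suc k) a b = a # alts k b a"

text \<open>The entry at position \<open>k\<close>, counted from 0, of the infinite alternating
  word: the letter that prolongs \<open>alts k a b\<close>.\<close>

definition next_letter :: "nat \<Rightarrow> 'a \<Rightarrow> 'a \<Rightarrow> 'a" where
  "next_letter k a b = (if even k then a else b)"

lemma length_alts [simp]: "length (alts k a b) = k"
  by (induction k arbitrary: a b) auto

lemma set_alts: "set (alts k a b) \<subseteq> {a, b}"
  by (induction k arbitrary: a b) fastforce+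

lemma alts_lists: "a \<in> A \<Longrightarrow> b \<in> A \<Longrightarrow> alts k a b \<in> lists A"
  using set_alts[of k a b] by auto

lemma alts_Suc_snoc: "alts (Suc k) a b = alts k a b @ [next_letter k a b]"
  by (induction k arbitrary: a b) (auto simp: next_letter_def)

lemma alts_add: "\<exists>z\<in>lists {a, b}. length z = l \<and> alts (k + l) a b = alts k a b @ z"
proof (induction l)
  case (Suc l)
  then obtain z where "z \<in> lists {a, b}" "length z = l" "alts (k + l) a b = alts k a b @ z"
    by blast
  then show ?case
    using alts_Suc_snoc[of "k + l" a b]
    by (intro bexI[of _ "z @ [next_letter (k + l) a b]"]) (auto simp: next_letter_def)
qed auto

text \<open>The Chebyshev polynomial of the second kind of degree \<open>k - 1\<close> at
  \<open>angle_cos \<mu>\<close>; for an infinite label the quotient of sines is replaced by its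
  limit \<open>k\<close>.\<close>

definition cheb :: "enat \<Rightarrow> nat \<Rightarrow> real" where
  "cheb \<mu> k = (case \<mu> of enat \<mu> \<Rightarrow> sin (k * pi / \<mu>) / sin (pi / \<mu>) | \<infinity> \<Rightarrow> k)"

lemma sin_pi_div_pos: "2 \<le> enat k \<Longrightarrow> 0 < sin (pi / real k)"
  by (rule sin_gt_zero) (auto simp: numeral_eq_enat field_simps)

lemma cheb_0 [simp]: "cheb \<mu> 0 = 0"
  by (auto simp: cheb_def split: enat.splits)

lemma cheb_1 [simp]: "2 \<le> \<mu> \<Longrightarrow> cheb \<mu> (Suc 0) = 1"
  using sin_pi_div_pos by (fastforce simp: cheb_def split: enat.splits)

lemma cheb_Suc_Suc: "cheb \<mu> (Suc (Suc k)) = 2 * angle_cos \<mu> * cheb \<mu> (Suc k) - cheb \<mu> k"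
proof (cases \<mu>)
  case (enat l)
  let ?x = "pi / real l"
  have "sin ((k + 1) * ?x + ?x) + sin ((k + 1) * ?x - ?x) = 2 * cos ?x * sin ((k + 1) * ?x)"
    unfolding sin_add sin_diff by simp
  moreover have "(k + 1) * ?x + ?x = (k + 2) * ?x" "(k + 1) * ?x - ?x = k * ?x"
    by (simp_all add: distrib_right left_diff_distrib add_divide_distrib)
  ultimately have "sin ((k + 2) * ?x) = 2 * cos ?x * sin ((k + 1) * ?x) - sin (k * ?x)"
    by simp
  then show ?thesis
    by (simp add: cheb_def angle_cos_def enat diff_divide_distrib add.commute)
qed (simp add: cheb_def angle_cos_def)

lemma cheb_pos: "2 \<le> \<mu> \<Longrightarrow> 0 < k \<Longrightarrow> enat k < \<mu> \<Longrightarrow> 0 < cheb \<mu> k"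
proof (cases \<mu>)
  case (enat l)
  assume "2 \<le> \<mu>" "0 < k" "enat k < \<mu>"
  moreover have "0 < sin (real k * pi / real l)"
    using \<open>0 < k\<close> \<open>enat k < \<mu>\<close> enat by (intro sin_gt_zero) (auto simp: field_simps)
  ultimately show ?thesis
    using sin_pi_div_pos enat by (auto simp: cheb_def)
qed (simp add: cheb_def)

text \<open>From \<open>sin (pi - x) = sin x\<close>. This symmetry lists the dihedral roots
  backwards, from \<alpha> t to \<alpha> s.\<close>

lemma cheb_flip: "2 \<le> \<mu> \<Longrightarrow> \<mu> = enat l \<Longrightarrow> k \<le> l \<Longrightarrow> cheb \<mu> (l - k) = cheb \<mu> k"
proof -
  assume *: "2 \<le> \<mu>" "\<mu> = enat l" "k \<le> l"
  then have "0 < l" by (cases l) (auto simp: numeral_eq_enat)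
  then have "real (l - k) * pi / real l = pi - real k * pi / real l"
    using * by (simp add: field_simps of_nat_diff)
  then show ?thesis using * by (simp add: cheb_def)
qed

lemma cheb_end: "2 \<le> enat l \<Longrightarrow> cheb (enat l) l = 0"
  using cheb_flip[of "enat l" l 0] by simp

lemma cheb_nonneg: "2 \<le> \<mu> \<Longrightarrow> enat k \<le> \<mu> \<Longrightarrow> 0 \<le> cheb \<mu> k"
  using cheb_pos[of \<mu> k] cheb_end[of k] by (cases "k = 0") (auto simp: le_less)

lemma cheb_penultimate: "2 \<le> enat (Suc l) \<Longrightarrow> cheb (enat (Suc l)) l = 1"
  using cheb_flip[of "enat (Suc l)" "Suc l" "Suc 0"] by (cases l) (auto simp: numeral_eq_enat)

lemma cheb_after_end: "2 \<le> enat l \<Longrightarrow> cheb (enat l) (Suc l) = - 1"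
  using cheb_Suc_Suc[of "enat l" "l - 1"] cheb_end[of l] cheb_penultimate[of "l - 1"]
  by (cases l) (auto simp: numeral_eq_enat)

text \<open>For \<open>k\<close> below a finite label \<open>m s t\<close> these are the positive
  roots of the dihedral subsystem of \<open>s\<close> and \<open>t\<close>, in order from \<alpha> s
  to \<alpha> t.\<close>

abbreviation dihedral_root :: "nat \<Rightarrow> 'a \<Rightarrow> 'a \<Rightarrow> 'a \<Rightarrow> real" where
  "dihedral_root k s t \<equiv> (\<lambda>i. cheb (m s t) (Suc k) * \<alpha> s i + cheb (m s t) k * \<alpha> t i)"

text \<open>This is the three-term recurrence \<open>cheb_Suc_Suc\<close> in geometric form; the
  roles of \<open>s\<close> and \<open>t\<close> are exchanged on the left.\<close>

lemma reflect_dihedral_root: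
  assumes "s \<in> S" "t \<in> S" "s \<noteq> t"
  shows "reflect s (dihedral_root k t s) = dihedral_root (Suc k) s t"
  using assms
  unfolding reflect_lincomb
  by (auto simp: reflect_simple_root gram_def cheb_Suc_Suc m_sym[of t s] algebra_simps)

lemma act_alts_next:
  assumes "s \<in> S" "t \<in> S" "s \<noteq> t"
  shows "act (alts k s t) (\<alpha> (next_letter k s t)) = dihedral_root k s t"
  using assms
proof (induction k arbitrary: s t)
  case 0
  then show ?case by (simp add: next_letter_def m_ge_2)
next
  case (Suc k)
  have "next_letter (Suc k) s t = next_letter k t s" by (simp add: next_letter_def)
  then show ?case using Suc reflect_dihedral_root by auto
qed

lemma act_alts_last:
  assumes "s \<in> S" "t \<in> S" "s \<noteq> t"
  shows "act (alts (Suc k) s t) (\<alpha> (next_letter k s t)) = (\<lambda>i. - dihedral_root k s t i)"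
proof -
  have "next_letter k s t \<in> S" using assms by (simp add: next_letter_def)
  then show ?thesis
    using act_scale[of "alts k s t" "-1"] act_alts_next[OF assms]
    unfolding alts_Suc_snoc act_append by (simp add: reflect_simple_root_self)
qed

text \<open>The full alternating word is the longest element of the dihedral group. One simple root
  goes to the dihedral root of index \<open>k\<close>, where the coefficients are -1 and 0, and the
  other to minus the root of index \<open>k - 1\<close>, which is \<alpha> t.\<close>

lemma act_alts_full:
  assumes "s \<in> S" "t \<in> S" "s \<noteq> t" "m s t = enat k"
  shows "act (alts k s t) (\<alpha> s) = (\<lambda>i. - \<alpha> (if even k then s else t) i)"
    and "act (alts k s t) (\<alpha> t) = (\<lambda>i. - \<alpha> (if even k then t else s) i)"
proof -
  have k: "2 \<le> enat k" using m_ge_2 assms by metis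
  then obtain l where l: "k = Suc l" by (cases k) (auto simp: numeral_eq_enat)
  have 1: "act (alts k s t) (\<alpha> (next_letter k s t)) = (\<lambda>i. - \<alpha> s i)"
    using act_alts_next[OF assms(1-3), of k] assms(4) cheb_end[OF k] cheb_after_end[OF k] by simp
  have 2: "act (alts k s t) (\<alpha> (next_letter l s t)) = (\<lambda>i. - \<alpha> t i)"
    using act_alts_last[OF assms(1-3), of l] assms(4) cheb_end[OF k] cheb_penultimate[of l] k l
    by simp
  show "act (alts k s t) (\<alpha> s) = (\<lambda>i. - \<alpha> (if even k then s else t) i)"
    "act (alts k s t) (\<alpha> t) = (\<lambda>i. - \<alpha> (if even k then t else s) i)"
    using 1 2 l by (auto simp: next_letter_def)
qed

lemma act_fixed:
  assumes "\<And>s. s \<in> set w \<Longrightarrow> pairing s z = 0" shows "act w z = z"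
  using assms by (induction w) (auto simp: reflect_def)

text \<open>The Gram determinant of \<alpha> s and \<alpha> t is the square of
  \<open>sin (pi / k)\<close>, hence nonzero, so every vector splits into a part in their plane and
  a part orthogonal to both. Both words fix the second part and agree on the first by
  \<open>act_alts_full\<close>.\<close>

lemma act_alts_braid:
  assumes "s \<in> S" "t \<in> S" "s \<noteq> t" "m s t = enat k"
  shows "act (alts k s t) = act (alts k t s)"
proof
  fix v
  define c where "c = cos (pi / k)"
  have k: "2 \<le> enat k" using m_ge_2 assms by metis
  have "(sin (pi / k))\<^sup>2 > 0"
    using sin_pi_div_pos[OF k] by simp
  then have c: "1 - c * c \<noteq> 0"
    unfolding c_def using sin_squared_eq[of "pi / k"] by (simp add: power2_eq_square)
  \<comment> \<open>\<open>a\<close> and \<open>b\<close> solve the Gram system of the plane by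
    Cramer's rule, so that \<open>w\<close> is the orthogonal projection of
    \<open>v\<close>.\<close>
  define a where "a = (pairing s v + c * pairing t v) / (1 - c * c)"
  define b where "b = (pairing t v + c * pairing s v) / (1 - c * c)"
  define w where "w = (\<lambda>i. a * \<alpha> s i + b * \<alpha> t i)"
  define z where "z = (\<lambda>i. 1 * v i + (- 1) * w i)"
  have g: "gram s t = - c" "gram t s = - c"
    using assms m_sym[of s t] by (auto simp: gram_def angle_cos_def c_def)
  have s: "pairing s v = a - c * b"
    using c by (simp add: a_def b_def divide_simps) (simp add: algebra_simps)
  have t: "pairing t v = b - c * a"
    using c by (simp add: a_def b_def divide_simps) (simp add: algebra_simps)
  have "pairing s z = 0" "pairing t z = 0"
    unfolding z_def w_def pairing_lincomb using assms g s t by (auto simp: pairing_simple_root)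
  then have z: "act (alts k s t) z = z" "act (alts k t s) z = z"
    using set_alts[of k s t] set_alts[of k t s] by (auto intro!: act_fixed)
  have v: "v = (\<lambda>i. 1 * z i + 1 * w i)"
    by (simp add: z_def)
  have "m t s = enat k" using assms m_sym by metis
  then have "act (alts k s t) w = act (alts k t s) w"
    unfolding w_def act_lincomb using act_alts_full[of s t k] act_alts_full[of t s k] assms by simp
  then show "act (alts k s t) v = act (alts k t s) v"
    by (subst (1 2) v, unfold act_lincomb z) simp
qed

section \<open>Reduced words and the sign of roots\<close>

definition reduced :: "'a list \<Rightarrow> bool" where
  "reduced w \<longleftrightarrow> w \<in> lists S \<and> (\<forall>w'\<in>lists S. act w' = act w \<longrightarrow> length w \<le> length w')"

lemma ex_reduced:
  assumes "w \<in> lists S"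
  shows "\<exists>w'. reduced w' \<and> act w' = act w \<and> length w' \<le> length w"
proof -
  have "\<exists>w'. (w' \<in> lists S \<and> act w' = act w) \<and>
      (\<forall>y. y \<in> lists S \<and> act y = act w \<longrightarrow> length w' \<le> length y)"
    using assms by (intro ex_has_least_nat[of _ w]) auto
  then obtain w' where "w' \<in> lists S" "act w' = act w"
      "\<And>y. y \<in> lists S \<Longrightarrow> act y = act w \<Longrightarrow> length w' \<le> length y"
    by blast
  then show ?thesis using assms unfolding reduced_def by (intro exI[of _ w']) metis
qed

lemma act_snoc_cancel: "s \<in> S \<Longrightarrow> act (w @ [s, s]) = act w"
  by (simp add: act_append reflect_comp_reflect)

text \<open>A braid move on the \<open>l\<close> letters after the first one brings a second
  \<open>c\<close> to the front, and the two cancel.\<close>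

lemma shorter_after_alts:
  assumes "c \<in> S" "d \<in> S" "c \<noteq> d" "m c d = enat l" "l \<le> k"
  shows "\<exists>z\<in>lists S. act z = act (alts (Suc k) c d) \<and> length z < k"
proof -
  have l: "2 \<le> enat l" using m_ge_2 assms by metis
  then obtain l' where l': "l = Suc l'" by (cases l) (auto simp: numeral_eq_enat)
  obtain z where z: "z \<in> lists {d, c}" "length z = k - l" "alts k d c = alts l d c @ z"
    using alts_add[of d c "k - l" l] assms by auto
  have "act (alts (Suc k) c d) = reflect c \<circ> (act (alts l c d) \<circ> act z)"
    using z act_alts_braid[OF assms(1-4)] by (simp add: act_append)
  also have "\<dots> = act (alts l' d c @ z)"
    using assms by (simp add: l' act_append fun_eq_iff reflect_reflect)
  finally have "act (alts (Suc k) c d) = act (alts l' d c @ z)" .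
  moreover have "alts l' d c @ z \<in> lists S"
    using z assms alts_lists[of d S c] by auto
  ultimately show ?thesis using z l' assms by (intro bexI[of _ "alts l' d c @ z"]) auto
qed

text \<open>The action preserves the form and simple roots have norm 1, so
  \<open>a * a = 1\<close>.\<close>

lemma root_eq_simple_root_scale:
  assumes "w \<in> lists S" "s \<in> S" "x \<in> S" "0 \<le> a" "act w (\<alpha> s) = (\<lambda>i. a * \<alpha> x i)"
  shows "act w (\<alpha> s) = \<alpha> x"
proof -
  have "form (act w (\<alpha> s)) (act w (\<alpha> s)) = 1"
    using assms(1,2) by (subst form_act) (simp_all add: form_simple_root_left pairing_simple_root)
  moreover have "form (\<lambda>i. a * \<alpha> x i) (\<lambda>i. a * \<alpha> x i) = a * a"
    using form_lincomb_left[of a "\<alpha> x" 0 "\<alpha> x" "\<lambda>i. a * \<alpha> x i"]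
      pairing_lincomb[of x a "\<alpha> x" 0 "\<alpha> x"] assms
    by (simp add: form_simple_root_left pairing_simple_root)
  ultimately have "a = 1"
    using assms by (metis mult_cancel_right1 mult_less_cancel_left1 power2_eq_1_iff power2_eq_square
      le_minus_one_simps(3) linorder_not_le order_trans)
  then show ?thesis using assms by simp
qed

text \<open>The conclusion on \<open>f\<close> says that only generators joined by odd edges have conjugate reflections.
  The induction splits off from \<open>w\<close> a longest alternating suffix in \<open>s\<close> and the last letter of \<open>w\<close>,
  on which the Chebyshev values are explicit.\<close>

lemma reduced_root_nonneg:
  assumes odd: "\<And>s t k. s \<in> S \<Longrightarrow> t \<in> S \<Longrightarrow> s \<noteq> t \<Longrightarrow> m s t = enat k \<Longrightarrow> odd k \<Longrightarrow> f s = f t"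
    and "reduced w" "s \<in> S"
    and "\<And>w'. w' \<in> lists S \<Longrightarrow> act w' = act (w @ [s]) \<Longrightarrow> length w \<le> length w'"
  shows "(\<forall>i. 0 \<le> act w (\<alpha> s) i) \<and> (\<forall>x\<in>S. act w (\<alpha> s) = \<alpha> x \<longrightarrow> f s = f x)"
  using assms(2-)
proof (induction "length w" arbitrary: w s rule: less_induct)
  case (less w s)
  have w: "w \<in> lists S" and min: "\<And>w'. w' \<in> lists S \<Longrightarrow> act w' = act w \<Longrightarrow> length w \<le> length w'"
    using less.prems(1) by (auto simp: reduced_def)
  show ?case
  proof (cases w rule: rev_cases)
    case Nil
    then show ?thesis by (auto simp: simple_root_def)
      (metis zero_neq_one)
  next
    case (snoc w0 t)
    have ts: "t \<noteq> s"
    proof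
      assume "t = s"
      then have "act w0 = act (w @ [s])"
        using snoc \<open>s \<in> S\<close> act_snoc_cancel by simp
      then show False using less.prems(3)[of w0] snoc w by auto
    qed
    \<comment> \<open>The element \<open>w\<close> is factored without loss of length into
      \<open>v\<close> and an alternating tail of \<open>k\<close> letters that \<open>s\<close>
      would prolong. Only actions are compared, so \<open>v\<close> need not be a prefix of
      \<open>w\<close>.\<close>
    define P where "P k v c d \<longleftrightarrow> v \<in> lists S \<and> c \<in> S \<and> d \<in> S \<and> c \<noteq> d \<and> next_letter k c d = s
      \<and> act w = act v \<circ> act (alts k c d) \<and> length v + k = length w" for k v c d
    have P1: "P 1 w0 t s"
      using snoc w ts \<open>s \<in> S\<close> by (auto simp: P_def next_letter_def act_append)
    have "\<exists>k. (\<exists>v c d. P k v c d) \<and> (\<forall>y. (\<exists>v c d. P y v c d) \<longrightarrow> y \<le> k)"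
      using P1 by (intro ex_has_greatest_nat[of _ 1 "\<lambda>x. x" "Suc (length w)"]) (auto simp: P_def)
    then obtain k v c d where P: "P k v c d" and max: "\<And>y v c d. P y v c d \<Longrightarrow> y \<le> k"
      by blast
    have k: "1 \<le> k" using max P1 by blast
    have v: "v \<in> lists S" "c \<in> S" "d \<in> S" "c \<noteq> d" "next_letter k c d = s"
      "act w = act v \<circ> act (alts k c d)" "length v + k = length w"
      using P by (auto simp: P_def)
    have red: "reduced v"
      unfolding reduced_def
    proof (intro conjI ballI impI)
      fix v' assume "v' \<in> lists S" "act v' = act v"
      then show "length v \<le> length v'"
        using min[of "v' @ alts k c d"] v alts_lists[of c S d k] by (auto simp: act_append)
    qed (use v in auto)
    \<comment> \<open>The tail starts with \<open>c\<close>, so a shorter word for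
      \<open>v @ [c]\<close> would shorten \<open>w\<close>.\<close>
    have minc: "length v \<le> length v'" if "v' \<in> lists S" "act v' = act (v @ [c])" for v'
    proof -
      obtain k' where k': "k = Suc k'" using k by (cases k) auto
      have "act w = act (v' @ alts k' d c)"
        using v that by (simp add: act_append k' o_assoc)
      then show ?thesis
        using min[of "v' @ alts k' d c"] v that alts_lists[of d S c k'] k' by auto
    qed
    \<comment> \<open>A shorter word for \<open>v @ [d]\<close> would allow the tail
      \<open>alts (Suc k) d c\<close>, against the maximality of \<open>k\<close>.\<close>
    have mind: "length v \<le> length v'" if v': "v' \<in> lists S" "act v' = act (v @ [d])" for v'
    proof (rule ccontr)
      assume "\<not> ?thesis"
      then have less: "length v' < length v" by simp
      have eq: "act w = act v' \<circ> act (alts (Suc k) d c)"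
        using v v' by (simp add: act_append fun_eq_iff reflect_reflect)
      moreover have "v' @ alts (Suc k) d c \<in> lists S"
        using v' v alts_lists[of d S c "Suc k"] by auto
      ultimately have "length w \<le> length v' + Suc k"
        using min[of "v' @ alts (Suc k) d c"] by (simp add: act_append)
      then have "P (Suc k) v' d c"
        using less v v' eq by (auto simp: P_def next_letter_def)
      then show False using max by fastforce
    qed
    \<comment> \<open>Otherwise the tail followed by \<open>s\<close> is longer than the label and
      can be shortened, against the minimality assumed for \<open>w @ [s]\<close>.\<close>
    have km: "enat k < m c d"
    proof (rule ccontr)
      assume "\<not> ?thesis"
      then obtain l where "m c d = enat l" "l \<le> k"
        by (cases "m c d") auto
      then obtain z where z: "z \<in> lists S" "act z = act (alts (Suc k) c d)" "length z < k"
        using shorter_after_alts v by blast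
      then have "act (v @ z) = act (w @ [s])"
        using v alts_Suc_snoc[of k c d] by (simp add: act_append o_assoc del: alts.simps)
      then show False using less.prems(3)[of "v @ z"] z v by auto
    qed
    have m2: "2 \<le> m c d" using m_ge_2 v by blast
    let ?a = "cheb (m c d) (Suc k)" and ?b = "cheb (m c d) k"
    have b: "?b > 0" using cheb_pos m2 km k by simp
    have a: "?a \<ge> 0" using cheb_nonneg m2 km by (simp add: Suc_ile_eq)
    have eq: "act w (\<alpha> s) = (\<lambda>i. ?a * act v (\<alpha> c) i + ?b * act v (\<alpha> d) i)"
      using v act_alts_next[of c d k] act_lincomb by simp
    have "length v < length w" using k v by simp
    note IH = less.hyps[OF this red]
    have IHc: "(\<forall>i. 0 \<le> act v (\<alpha> c) i)"
      using IH[of c] minc v by blast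
    have IHd: "(\<forall>i. 0 \<le> act v (\<alpha> d) i)" "\<forall>x\<in>S. act v (\<alpha> d) = \<alpha> x \<longrightarrow> f d = f x"
      using IH[of d] mind v by blast+
    have "f s = f x" if x: "x \<in> S" "act w (\<alpha> s) = \<alpha> x" for x
    proof -
      have z: "?a * act v (\<alpha> c) i = 0 \<and> act v (\<alpha> d) i = 0" if "i \<noteq> x" for i
      proof -
        have "?a * act v (\<alpha> c) i + ?b * act v (\<alpha> d) i = 0"
          using x that eq by (metis simple_root_def)
        moreover have "0 \<le> ?a * act v (\<alpha> c) i" "0 \<le> ?b * act v (\<alpha> d) i"
          using a b IHc IHd by simp_all
        ultimately show ?thesis using b by (simp add: add_nonneg_eq_0_iff)
      qed
      have scale: "u = (\<lambda>i. u x * \<alpha> x i)" if "\<And>i. i \<noteq> x \<Longrightarrow> u i = 0" for u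
        using that by (auto simp: simple_root_def)
      have d: "act v (\<alpha> d) = \<alpha> x"
        using root_eq_simple_root_scale[OF v(1,3) x(1), of "act v (\<alpha> d) x"] scale z IHd by blast
      \<comment> \<open>With a nonzero coefficient \<open>?a\<close> the roots of \<open>c\<close>
        and \<open>d\<close> would both be mapped to \<alpha> x, contradicting injectivity.\<close>
      have a0: "?a = 0"
      proof (rule ccontr)
        assume "?a \<noteq> 0"
        then have "act v (\<alpha> c) = \<alpha> x"
          using root_eq_simple_root_scale[OF v(1,2) x(1), of "act v (\<alpha> c) x"] scale z IHc
          by (metis mult_eq_0_iff)
        then show False using d act_inject[OF v(1)] v(4) by (metis simple_root_inject)
      qed
      have "m c d = enat (Suc k)"
      proof (rule ccontr)
        assume "m c d \<noteq> enat (Suc k)"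
        then have "enat (Suc k) < m c d" using km by (metis Suc_ile_eq order_le_less)
        then show False using cheb_pos[OF m2, of "Suc k"] a0 by simp
      qed
      \<comment> \<open>For odd \<open>k\<close> the letter \<open>s\<close> is \<open>d\<close>
        itself; for even \<open>k\<close> it is \<open>c\<close>, and the label \<open>Suc k\<close>
        of \<open>c\<close> and \<open>d\<close> is odd.\<close>
      then have "f d = f s"
        using odd[of c d "Suc k"] v by (auto simp: next_letter_def split: if_splits)
      then show ?thesis using d IHd x by auto
    qed
    moreover have "0 \<le> act w (\<alpha> s) i" for i
      using eq a b IHc IHd by simp
    ultimately show ?thesis by blast
  qed
qed

text \<open>Let \<open>v\<close> be a reduced form of \<open>w\<close>. Unless
  \<open>reduced_root_nonneg\<close> applies to \<open>v\<close>, appending \<open>s\<close>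
  shortens it, and the root is minus the nonnegative root of a reduced form of
  \<open>v @ [s]\<close>.\<close>

lemma root_sign_cases:
  assumes odd: "\<And>s t k. s \<in> S \<Longrightarrow> t \<in> S \<Longrightarrow> s \<noteq> t \<Longrightarrow> m s t = enat k \<Longrightarrow> odd k \<Longrightarrow> f s = f t"
    and "w \<in> lists S" "s \<in> S"
  shows "(\<forall>i. 0 \<le> act w (\<alpha> s) i) \<and> (\<forall>x\<in>S. act w (\<alpha> s) = \<alpha> x \<longrightarrow> f s = f x)
    \<or> (\<forall>i. act w (\<alpha> s) i \<le> 0)"
proof -
  obtain v where v: "reduced v" "act v = act w" using ex_reduced assms by blast
  show ?thesis
  proof (cases "\<forall>w'\<in>lists S. act w' = act (v @ [s]) \<longrightarrow> length v \<le> length w'")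
    case True
    then show ?thesis using reduced_root_nonneg[of f v s] v assms by auto
  next
    case False
    then obtain u where u: "u \<in> lists S" "act u = act (v @ [s])" "length u < length v"
      by (meson not_le)
    then obtain u' where u': "reduced u'" "act u' = act u" "length u' \<le> length u"
      using ex_reduced by blast
    have us: "act (u' @ [s]) = act v"
      using u u' assms by (simp add: act_append fun_eq_iff reflect_reflect)
    have "length u' \<le> length x" if "x \<in> lists S" "act x = act (u' @ [s])" for x
    proof -
      have "length v \<le> length x" using that us v(1) by (simp add: reduced_def)
      then show ?thesis using u u' by simp
    qed
    then have nonneg: "\<forall>i. 0 \<le> act u' (\<alpha> s) i"
      using reduced_root_nonneg[of f u' s] odd u'(1) assms(3) by blast
    have "act u' \<circ> reflect s = act w"
      using us v(2) by (simp add: act_append)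
    then have "act w (\<alpha> s) = act u' (reflect s (\<alpha> s))"
      by (metis comp_apply)
    also have "\<dots> = (\<lambda>i. - act u' (\<alpha> s) i)"
      using act_scale[of u' "- 1" "\<alpha> s"] assms(3) by (simp add: reflect_simple_root_self)
    finally have "act w (\<alpha> s) = (\<lambda>i. - act u' (\<alpha> s) i)" .
    then show ?thesis using nonneg by simp
  qed
qed

lemma root_nonneg_or_nonpos:
  assumes "w \<in> lists S" "s \<in> S"
  shows "(\<forall>i. 0 \<le> act w (\<alpha> s) i) \<or> (\<forall>i. act w (\<alpha> s) i \<le> 0)"
  using root_sign_cases[of "\<lambda>_. ()" w s] assms by auto

lemma odd_invariant_eq:
  assumes "\<And>s t k. s \<in> S \<Longrightarrow> t \<in> S \<Longrightarrow> s \<noteq> t \<Longrightarrow> m s t = enat k \<Longrightarrow> odd k \<Longrightarrow> f s = f t"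
    and "w \<in> lists S" "s \<in> S" "x \<in> S" "act w (\<alpha> s) = \<alpha> x"
  shows "f s = f x"
proof -
  have "\<not> (\<forall>i. \<alpha> x i \<le> 0)" by (auto intro!: exI[of _ x])
  then show ?thesis using root_sign_cases[of f w s] assms by auto
qed

end

section \<open>Retractions onto standard subgroups\<close>

locale braid_presentation = coxeter_form S m for S :: "'a set" and m +
  fixes T :: "'a set" and R :: "('a gword \<times> 'a gword) set"
  assumes T_sub: "T \<subseteq> S"
    and odd_T: "s \<in> S \<Longrightarrow> t \<in> S \<Longrightarrow> s \<noteq> t \<Longrightarrow> m s t = enat k \<Longrightarrow> odd k \<Longrightarrow> s \<in> T \<longleftrightarrow> t \<in> T"
    and rel_cases: "(l, r) \<in> R \<Longrightarrow>
      (\<exists>s\<in>T. l = [(s, True), (s, True)] \<and> r = []) \<or>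
      (\<exists>s\<in>S. \<exists>t\<in>S. \<exists>k. s \<noteq> t \<and> m s t = enat k \<and> l = alt_word s t k \<and> r = alt_word t s k)"
    and involution_cong: "s \<in> T \<Longrightarrow> ([(s, True), (s, True)], []) \<in> pres_cong S R"
    and braid_cong: "s \<in> S \<Longrightarrow> t \<in> S \<Longrightarrow> s \<noteq> t \<Longrightarrow> m s t = enat k \<Longrightarrow>
      (alt_word s t k, alt_word t s k) \<in> pres_cong S R"
begin

section \<open>Reading words and the states reached\<close>

fun run :: "'a set \<Rightarrow> (('a \<Rightarrow> real) \<Rightarrow> 'a \<Rightarrow> real) \<Rightarrow> 'a gword \<Rightarrow>
    'a gword \<times> (('a \<Rightarrow> real) \<Rightarrow> 'a \<Rightarrow> real)" where
  "run X g [] = ([], g)"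
| "run X g (l # w) =
    (if \<exists>x\<in>X. g (\<alpha> x) = \<alpha> (fst l)
     then apfst ((#) (THE x. x \<in> X \<and> g (\<alpha> x) = \<alpha> (fst l), snd l)) (run X g w)
     else run X (reflect (fst l) \<circ> g) w)"

definition state :: "'a set \<Rightarrow> (('a \<Rightarrow> real) \<Rightarrow> 'a \<Rightarrow> real) \<Rightarrow> bool" where
  "state X g \<longleftrightarrow> (\<exists>w\<in>lists S. g = act w) \<and> (\<forall>x\<in>X. \<forall>i. 0 \<le> g (\<alpha> x) i)"

definition equiv_runs :: "'a set \<Rightarrow> (('a \<Rightarrow> real) \<Rightarrow> 'a \<Rightarrow> real) \<Rightarrow> 'a gword \<Rightarrow> 'a gword \<Rightarrow> bool" where
  "equiv_runs X g u v \<longleftrightarrow>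
    (fst (run X g u), fst (run X g v)) \<in> pres_cong S R \<and> snd (run X g u) = snd (run X g v)"

lemma state_id: "state X id"
  unfolding state_def by (auto intro!: bexI[of _ "[]"] simp: simple_root_def)

lemma state_inject: "state X g \<Longrightarrow> g u = g v \<longleftrightarrow> u = v"
  unfolding state_def using act_inject by blast

text \<open>A state is injective, so the letter chosen by \<open>THE\<close> is unique. The exponent
  is copied to the output and does not enter the test.\<close>

lemma run_loop:
  assumes "state X g" "x \<in> X" "g (\<alpha> x) = \<alpha> s"
  shows "run X g ((s, e) # w) = apfst ((#) (x, e)) (run X g w)"
proof -
  have "(THE x. x \<in> X \<and> g (\<alpha> x) = \<alpha> s) = x"
    using assms by (intro the_equality) (auto simp flip: assms(3) simp: state_inject)
  then show ?thesis using assms by auto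
qed

text \<open>A reflection in \<open>s\<close> changes only the coordinate at \<open>s\<close>. A
  nonnegative root that it makes nonpositive is therefore a multiple of \<alpha> s, hence equal to
  it, and this is the excluded case.\<close>

lemma state_step:
  assumes "X \<subseteq> S" "state X g" "s \<in> S" "\<not> (\<exists>x\<in>X. g (\<alpha> x) = \<alpha> s)"
  shows "state X (reflect s \<circ> g)"
proof -
  obtain w where w: "w \<in> lists S" "g = act w" using assms by (auto simp: state_def)
  have "0 \<le> reflect s (g (\<alpha> x)) i" if "x \<in> X" for x i
  proof (rule ccontr)
    assume "\<not> ?thesis"
    then have le: "\<And>i. reflect s (g (\<alpha> x)) i \<le> 0"
      using root_nonneg_or_nonpos[of "s # w" x] w assms that by auto
    have ge: "0 \<le> g (\<alpha> x) i" for i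
      using assms that by (simp add: state_def)
    have "g (\<alpha> x) i = 0" if "i \<noteq> s" for i
      using le[of i] ge[of i] that by (simp add: reflect_def simple_root_def)
    moreover obtain a where a: "a = g (\<alpha> x) s" by blast
    ultimately have "act w (\<alpha> x) = (\<lambda>i. a * \<alpha> s i)"
      unfolding w(2) by (auto simp: simple_root_def)
    moreover have "x \<in> S" "0 \<le> a" using assms(1) that a ge by blast+
    ultimately have "g (\<alpha> x) = \<alpha> s"
      unfolding w(2) using root_eq_simple_root_scale[OF w(1) _ assms(3)] by blast
    then show False using assms that by blast
  qed
  moreover have "reflect s \<circ> g = act (s # w)" "s # w \<in> lists S"
    using w assms(3) by simp_all
  ultimately show ?thesis
    unfolding state_def comp_apply by blast
qed

lemma run_state:
  assumes "X \<subseteq> S"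
  shows "state X g \<Longrightarrow> w \<in> gwords S \<Longrightarrow> fst (run X g w) \<in> gwords X \<and> state X (snd (run X g w))"
proof (induction w arbitrary: g)
  case (Cons l w)
  obtain s e where l: "l = (s, e)" by (cases l)
  show ?case
  proof (cases "\<exists>x\<in>X. g (\<alpha> x) = \<alpha> s")
    case True
    then obtain x where "x \<in> X" "g (\<alpha> x) = \<alpha> s" by blast
    then show ?thesis using Cons l run_loop[of X g x s e w] by simp
  next
    case False
    then have "state X (reflect s \<circ> g)"
      using state_step[OF assms Cons.prems(1)] Cons.prems(2) l by simp
    then have "fst (run X (reflect s \<circ> g) w) \<in> gwords X \<and>
        state X (snd (run X (reflect s \<circ> g) w))"
      using Cons.prems(2) by (intro Cons.IH) (simp_all add: comp_def)
    then show ?thesis using l False by simp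
  qed
qed simp

lemma run_append:
  "run X g (u @ v) = apfst ((@) (fst (run X g u))) (run X (snd (run X g u)) v)"
  by (induction u arbitrary: g) (auto simp: apfst_def map_prod_def split: prod.splits)

text \<open>The prefix \<open>u\<close> leads to some state \<open>h\<close>, which is why
  \<open>l\<close> and \<open>r\<close> are compared from every state; the suffix \<open>v\<close>
  is then read from a common state.\<close>

lemma equiv_runs_context:
  assumes "X \<subseteq> S" "state X g" "u \<in> gwords S" "v \<in> gwords S" "l \<in> gwords S"
    and "\<And>h. state X h \<Longrightarrow> equiv_runs X h l r"
  shows "equiv_runs X g (u @ l @ v) (u @ r @ v)"
proof -
  define h where "h = snd (run X g u)"
  have h: "state X h" "fst (run X g u) \<in> gwords X"
    using run_state assms by (auto simp: h_def)
  then have lr: "equiv_runs X h l r" using assms by blast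
  define k where "k = snd (run X h l)"
  have "state X k" using run_state h assms by (auto simp: k_def)
  then have v: "fst (run X k v) \<in> gwords X" using run_state assms by auto
  have "gwords X \<subseteq> gwords S" using assms(1) unfolding gwords_def by (intro lists_mono) auto
  then show ?thesis
    using lr v h unfolding equiv_runs_def run_append
    by (auto simp: run_append h_def[symmetric] k_def[symmetric]
        intro!: pres_cong_append pres_cong.refl)
qed

text \<open>Such an \<open>x\<close> would have been mapped to the negative of \<alpha> s before the
  step. Hence a second letter \<open>s\<close> merely undoes a step.\<close>

lemma no_loop_after_step:
  assumes "state X g" "s \<in> S"
  shows "\<not> (\<exists>x\<in>X. (reflect s \<circ> g) (\<alpha> x) = \<alpha> s)"
proof
  assume "\<exists>x\<in>X. (reflect s \<circ> g) (\<alpha> x) = \<alpha> s"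
  then obtain x where x: "x \<in> X" "reflect s (g (\<alpha> x)) = \<alpha> s" by auto
  then have "g (\<alpha> x) = reflect s (\<alpha> s)"
    using assms(2) by (metis reflect_reflect)
  moreover have "0 \<le> g (\<alpha> x) s" using assms x by (simp add: state_def)
  ultimately show False using assms(2) by (simp add: reflect_simple_root_self)
qed

lemma equiv_runs_cancel:
  assumes "X \<subseteq> S" "state X g" "s \<in> S"
  shows "equiv_runs X g [(s, e), (s, \<not> e)] []"
proof (cases "\<exists>x\<in>X. g (\<alpha> x) = \<alpha> s")
  case True
  then obtain x where x: "x \<in> X" "g (\<alpha> x) = \<alpha> s" by blast
  then show ?thesis
    using pres_cong.cancel[of "[]" S "[]" x e R] assms
    by (auto simp: equiv_runs_def run_loop simp del: run.simps(2))
next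
  case False
  then show ?thesis
    using no_loop_after_step[OF assms(2,3)] assms(3)
    by (simp add: equiv_runs_def pres_cong.refl o_assoc reflect_comp_reflect)
qed

lemma equiv_runs_involution:
  assumes "X \<subseteq> S" "state X g" "s \<in> T"
  shows "equiv_runs X g [(s, True), (s, True)] []"
proof (cases "\<exists>x\<in>X. g (\<alpha> x) = \<alpha> s")
  case True
  then obtain x where x: "x \<in> X" "g (\<alpha> x) = \<alpha> s" by blast
  obtain w where "w \<in> lists S" "g = act w" using assms by (auto simp: state_def)
  \<comment> \<open>Since \<open>act w\<close> maps \<alpha> x to \<alpha> s, every function
    constant along odd edges agrees on \<open>x\<close> and \<open>s\<close>; membership in
    \<open>T\<close> is one by \<open>odd_T\<close>.\<close>
  then have "x \<in> T \<longleftrightarrow> s \<in> T"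
    using odd_invariant_eq[of "\<lambda>x. x \<in> T" w x s] odd_T x assms T_sub by blast
  then show ?thesis
    using x assms involution_cong
    by (auto simp: equiv_runs_def run_loop simp del: run.simps(2))
next
  case False
  have "s \<in> S" using assms T_sub by blast
  then show ?thesis
    using False no_loop_after_step[OF assms(2)]
    by (simp add: equiv_runs_def pres_cong.refl o_assoc reflect_comp_reflect)
qed

section \<open>Inversions and the braid relations\<close>

primrec inversions :: "'a list \<Rightarrow> ('a \<Rightarrow> real) set" where
  "inversions [] = {}"
| "inversions (s # w) = insert (\<alpha> s) (reflect s ` inversions w)"

lemma inversions_alts:
  assumes "s \<in> S" "t \<in> S" "s \<noteq> t"
  shows "inversions (alts k s t) = (\<lambda>i. dihedral_root i s t) ` {..<k}"
  using assms
proof (induction k arbitrary: s t)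
  case (Suc k)
  have "inversions (alts (Suc k) s t) = insert (\<alpha> s) (reflect s ` (\<lambda>i. dihedral_root i t s) ` {..<k})"
    using Suc by simp
  also have "\<dots> = insert (dihedral_root 0 s t) ((\<lambda>i. dihedral_root (Suc i) s t) ` {..<k})"
    using Suc.prems m_ge_2[of s t] by (simp only: image_image reflect_dihedral_root[OF Suc.prems]) simp
  also have "\<dots> = (\<lambda>i. dihedral_root i s t) ` {..<Suc k}"
    by (simp only: lessThan_Suc_eq_insert_0 image_insert image_image)
  finally show ?case .
qed simp

text \<open>Both sets are the positive dihedral roots, listed in opposite orders by
  \<open>cheb_flip\<close>.\<close>

lemma inversions_alts_sym:
  assumes "s \<in> S" "t \<in> S" "s \<noteq> t" "m s t = enat k"
  shows "inversions (alts k s t) = inversions (alts k t s)"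
proof -
  have "inversions (alts k s t) \<subseteq> inversions (alts k t s)"
    if "s \<in> S" "t \<in> S" "s \<noteq> t" "m s t = enat k" for s t
  proof -
    have m: "m t s = enat k" "2 \<le> enat k" using m_sym[of s t] m_ge_2[of s t] that by auto
    have "dihedral_root i s t \<in> (\<lambda>i. dihedral_root i t s) ` {..<k}" if "i < k" for i
    proof (rule image_eqI)
      have "Suc (k - Suc i) = k - i" using that by simp
      then show "dihedral_root i s t = dihedral_root (k - Suc i) t s"
        using cheb_flip[of "enat k" k i] cheb_flip[of "enat k" k "Suc i"] m \<open>m s t = enat k\<close> that
        by (simp add: add.commute)
    qed (use that in auto)
    then show ?thesis using that by (auto simp: inversions_alts)
  qed
  from this[of s t] this[of t s] show ?thesis using assms m_sym[of s t] by auto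
qed

definition positive_word :: "'a list \<Rightarrow> 'a gword" where
  "positive_word w = map (\<lambda>s. (s, True)) w"

lemma alt_word_Suc: "alt_word s t (Suc k) = (s, True) # alt_word t s k"
  by (simp add: alt_word_def upt_conv_Cons map_Suc_upt[symmetric] del: upt_Suc map_Suc_upt)

lemma alt_word_eq: "alt_word s t k = positive_word (alts k s t)"
  by (induction k arbitrary: s t)
     (auto simp: alt_word_Suc positive_word_def, simp add: alt_word_def)

text \<open>While nothing is written, the state after a prefix \<open>u\<close> is
  \<open>act (rev u) \<circ> g\<close>. It maps \<alpha> x to the root of the next letter
  \<open>s\<close> iff \<open>g (\<alpha> x) = act u (\<alpha> s)\<close>, and the right-hand sides
  are the elements of \<open>inversions w\<close>.\<close>

lemma run_avoiding_inversions:
  assumes "w \<in> lists S" "\<And>x. x \<in> X \<Longrightarrow> g (\<alpha> x) \<notin> inversions w"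
  shows "run X g (positive_word w) = ([], act (rev w) \<circ> g)"
  using assms
proof (induction w arbitrary: g rule: list.induct)
  case (Cons s w)
  have "(reflect s \<circ> g) (\<alpha> x) \<notin> inversions w" if "x \<in> X" for x
  proof
    assume "(reflect s \<circ> g) (\<alpha> x) \<in> inversions w"
    then have "reflect s (reflect s (g (\<alpha> x))) \<in> inversions (s # w)" by simp
    moreover have "reflect s (reflect s (g (\<alpha> x))) = g (\<alpha> x)"
      using Cons.prems(1) by (simp add: reflect_reflect)
    ultimately show False using Cons.prems(2)[OF that] by metis
  qed
  moreover have "\<not> (\<exists>x\<in>X. g (\<alpha> x) = \<alpha> s)" using Cons.prems by auto
  ultimately show ?case
    using Cons by (simp add: positive_word_def act_append o_assoc)
qed (simp add: positive_word_def)

text \<open>When \<open>x\<close> is written at the letter \<open>s\<close>, that reflection is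
  skipped; as it equals \<open>reflect x\<close> moved through the state, the final state carries a
  factor \<open>reflect x\<close>. The last hypothesis excludes a second letter being written after
  that.\<close>

lemma run_through_one_inversion:
  assumes "X \<subseteq> S" "state X g" "w \<in> lists S" "x \<in> X" "g (\<alpha> x) \<in> inversions w"
    and "\<And>y. y \<in> X \<Longrightarrow> y \<noteq> x \<Longrightarrow> g (\<alpha> y) \<notin> inversions w"
    and "\<And>y. y \<in> X \<Longrightarrow> g (reflect x (\<alpha> y)) \<notin> inversions w"
  shows "run X g (positive_word w) = ([(x, True)], act (rev w) \<circ> g \<circ> reflect x)"
  using assms
proof (induction w arbitrary: g)
  case (Cons s w)
  show ?case
  proof (cases "g (\<alpha> x) = \<alpha> s")
    case True
    obtain v where "v \<in> lists S" "g = act v" using Cons.prems by (auto simp: state_def)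
    then have sx: "reflect s \<circ> g = g \<circ> reflect x"
      using reflect_act_eq_act_reflect[of v s x] True Cons.prems by auto
    have "g (\<alpha> y) \<notin> inversions w" if "y \<in> X" for y
    proof
      assume "g (\<alpha> y) \<in> inversions w"
      then have "reflect s (g (\<alpha> y)) \<in> inversions (s # w)" by simp
      then show False using Cons.prems(7)[OF that] sx by (metis comp_apply)
    qed
    then have "run X g (positive_word w) = ([], act (rev w) \<circ> g)"
      using run_avoiding_inversions Cons.prems by auto
    moreover have comp: "act (rev (s # w)) \<circ> g \<circ> reflect x = act (rev w) \<circ> g"
    proof -
      have "act (rev (s # w)) \<circ> g \<circ> reflect x = act (rev w) \<circ> (reflect s \<circ> (g \<circ> reflect x))"
        by (simp add: act_append o_assoc)
      also have "\<dots> = act (rev w) \<circ> g"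
        using Cons.prems by (simp flip: sx add: o_assoc[of "reflect s"] reflect_comp_reflect)
      finally show ?thesis .
    qed
    moreover have "run X g (positive_word (s # w)) = apfst ((#) (x, True)) (run X g (positive_word w))"
      using run_loop[of X g x s True "positive_word w"] True Cons.prems
      by (simp add: positive_word_def del: run.simps)
    ultimately show ?thesis by (simp only: comp apfst_conv)
  next
    case False
    have no_loop: "\<not> (\<exists>y\<in>X. g (\<alpha> y) = \<alpha> s)"
      using Cons.prems(6) False by auto
    have st: "state X (reflect s \<circ> g)"
      using state_step Cons.prems no_loop by auto
    have *: "v \<notin> inversions (s # w) \<Longrightarrow> reflect s v \<notin> inversions w" for v
      using Cons.prems(3) reflect_reflect by (metis Cons_in_lists_iff imageI insertI2 inversions.simps(2))
    have "(reflect s \<circ> g) (\<alpha> x) \<in> inversions w"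
      using Cons.prems False by (auto simp: reflect_reflect)
    then have "run X (reflect s \<circ> g) (positive_word w)
        = ([(x, True)], act (rev w) \<circ> (reflect s \<circ> g) \<circ> reflect x)"
      using Cons.prems st * by (intro Cons.IH) (auto simp: comp_def)
    then show ?thesis using no_loop by (simp add: positive_word_def act_append comp_def)
  qed
qed simp

definition in_plane :: "'a \<Rightarrow> 'a \<Rightarrow> ('a \<Rightarrow> real) \<Rightarrow> bool" where
  "in_plane s t v \<longleftrightarrow> (\<exists>a b. v = (\<lambda>i. a * \<alpha> s i + b * \<alpha> t i))"

lemma in_plane_sym: "in_plane s t v \<longleftrightarrow> in_plane t s v"
  unfolding in_plane_def by (subst ex_comm) (simp add: add.commute)

lemma in_plane_lincomb:
  assumes "in_plane s t u" "in_plane s t v" shows "in_plane s t (\<lambda>i. a * u i + b * v i)"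
proof -
  obtain p q p' q' where "u = (\<lambda>i. p * \<alpha> s i + q * \<alpha> t i)" "v = (\<lambda>i. p' * \<alpha> s i + q' * \<alpha> t i)"
    using assms by (auto simp: in_plane_def)
  then show ?thesis unfolding in_plane_def
    by (intro exI[of _ "a * p + b * p'"] exI[of _ "a * q + b * q'"]) (auto simp: algebra_simps)
qed

lemma inversions_in_plane:
  assumes "s \<in> S" "t \<in> S" "s \<noteq> t" "v \<in> inversions (alts k s t)"
  shows "in_plane s t v"
  using assms unfolding inversions_alts[OF assms(1-3)] in_plane_def by blast

text \<open>The inverse image of \<open>\<alpha> s\<close> is a root in the span of \<open>\<alpha> x\<close> and \<open>\<alpha> y\<close>, so its coefficients have
  one sign; positivity then makes \<open>\<alpha> s\<close> extremal in the cone of \<open>g (\<alpha> x)\<close> and \<open>g (\<alpha> y)\<close>.\<close>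

lemma two_in_plane_simple:
  assumes "X \<subseteq> S" "state X g" "s \<in> S" "t \<in> S" "s \<noteq> t" "x \<in> X" "y \<in> X" "x \<noteq> y"
    and "in_plane s t (g (\<alpha> x))" "in_plane s t (g (\<alpha> y))"
  shows "g (\<alpha> x) = \<alpha> s \<or> g (\<alpha> y) = \<alpha> s"
proof -
  obtain w where w: "w \<in> lists S" "g = act w" using assms by (auto simp: state_def)
  obtain a b c d where x: "g (\<alpha> x) = (\<lambda>i. a * \<alpha> s i + b * \<alpha> t i)"
    and y: "g (\<alpha> y) = (\<lambda>i. c * \<alpha> s i + d * \<alpha> t i)"
    using assms by (auto simp: in_plane_def)
  have nn: "0 \<le> g (\<alpha> x) i" "0 \<le> g (\<alpha> y) i" for i
    using assms by (auto simp: state_def)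
  have "a \<ge> 0" "b \<ge> 0" "c \<ge> 0" "d \<ge> 0"
    using nn[of s] nn[of t] \<open>s \<noteq> t\<close> unfolding x y by simp_all
  have comb: "g (\<lambda>i. p * \<alpha> x i + q * \<alpha> y i) =
      (\<lambda>i. (p * a + q * c) * \<alpha> s i + (p * b + q * d) * \<alpha> t i)" for p q
    using x y act_lincomb[of w p "\<alpha> x" q "\<alpha> y"] w(2) by (auto simp: algebra_simps)
  have zero: "p = 0 \<and> q = 0" if "p * a + q * c = 0" "p * b + q * d = 0" for p q
  proof -
    have "g (\<lambda>i. p * \<alpha> x i + q * \<alpha> y i) = g (\<lambda>i. 0 * \<alpha> x i + 0 * \<alpha> y i)"
      unfolding comb using that by simp
    then have *: "(\<lambda>i. p * \<alpha> x i + q * \<alpha> y i) = (\<lambda>i. 0 * \<alpha> x i + 0 * \<alpha> y i)"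
      using state_inject assms by blast
    show ?thesis using fun_cong[OF *, of x] fun_cong[OF *, of y] \<open>x \<noteq> y\<close>
      by simp
  qed
  define D where "D = a * d - b * c"
  have "D \<noteq> 0"
  proof
    assume "D = 0"
    \<comment> \<open>The pairs \<open>(d, - b)\<close> and \<open>(- c, a)\<close> come from the
      adjugate matrix and lie in the kernel when the determinant \<open>D\<close> vanishes.\<close>
    then have "d = 0 \<and> - b = 0" "- c = 0 \<and> a = 0"
      using zero[of d "- b"] zero[of "- c" a] by (simp_all add: D_def algebra_simps)
    then show False using zero[of 1 0] by simp
  qed
  \<comment> \<open>Cramer's rule for writing \<alpha> s as a combination of
    \<open>g (\<alpha> x)\<close> and \<open>g (\<alpha> y)\<close>.\<close>
  define p q where "p = d / D" and "q = - b / D"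
  have pq: "p * a + q * c = 1" "p * b + q * d = 0"
    using \<open>D \<noteq> 0\<close> by (auto simp: p_def q_def field_simps) (simp add: D_def algebra_simps)
  then have gs: "g (\<lambda>i. p * \<alpha> x i + q * \<alpha> y i) = \<alpha> s"
    unfolding comb by simp
  then have inv: "act (rev w) (\<alpha> s) = (\<lambda>i. p * \<alpha> x i + q * \<alpha> y i)"
    using act_rev[OF w(1)] w(2) by metis
  have "0 \<le> p \<and> 0 \<le> q \<or> p \<le> 0 \<and> q \<le> 0"
  proof -
    have "rev w \<in> lists S" using w(1) by auto
    then consider "\<forall>i. 0 \<le> p * \<alpha> x i + q * \<alpha> y i" | "\<forall>i. p * \<alpha> x i + q * \<alpha> y i \<le> 0"
      using root_nonneg_or_nonpos[of "rev w" s] assms(3) inv by auto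
    then show ?thesis
    proof cases
      case 1
      from 1[rule_format, of x] 1[rule_format, of y] show ?thesis
        using \<open>x \<noteq> y\<close> by simp
    next
      case 2
      from 2[rule_format, of x] 2[rule_format, of y] show ?thesis
        using \<open>x \<noteq> y\<close> by simp
    qed
  qed
  moreover have "\<not> (p \<le> 0 \<and> q \<le> 0)"
    using pq(1) \<open>a \<ge> 0\<close> \<open>c \<ge> 0\<close> mult_nonpos_nonneg[of p a] mult_nonpos_nonneg[of q c] by linarith
  ultimately have "0 \<le> p" "0 \<le> q" "p > 0 \<or> q > 0" by auto
  then have "p * b = 0" "q * d = 0"
    using pq(2) \<open>b \<ge> 0\<close> \<open>d \<ge> 0\<close> by (simp_all add: add_nonneg_eq_0_iff)
  from \<open>p > 0 \<or> q > 0\<close> show ?thesis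
  proof
    assume "p > 0"
    then have "g (\<alpha> x) = (\<lambda>i. a * \<alpha> s i)" using \<open>p * b = 0\<close> x by simp
    then show ?thesis
      using root_eq_simple_root_scale[of w x s a] w assms \<open>a \<ge> 0\<close> by blast
  next
    assume "q > 0"
    then have "g (\<alpha> y) = (\<lambda>i. c * \<alpha> s i)" using \<open>q * d = 0\<close> y by simp
    then show ?thesis
      using root_eq_simple_root_scale[of w y s c] w assms \<open>c \<ge> 0\<close> by blast
  qed
qed

lemma run_alt_word_loops:
  assumes "state X g" "x \<in> X" "y \<in> X" "g (\<alpha> x) = \<alpha> s" "g (\<alpha> y) = \<alpha> t"
  shows "run X g (alt_word s t k) = (alt_word x y k, g)"
  using assms
proof (induction k arbitrary: x y s t)
  case (Suc k)
  then show ?case by (simp add: alt_word_Suc run_loop del: run.simps(2))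
qed (simp add: alt_word_def)

text \<open>The cosine is injective on the interval from 0 to pi and takes the value 1 of the
  infinite label there only at 0.\<close>

lemma angle_cos_inject:
  assumes "2 \<le> k" "2 \<le> l" "angle_cos k = angle_cos l" shows "k = l"
proof -
  have *: "0 < pi / real n \<and> pi / real n \<le> pi" if "2 \<le> enat n" for n
    using that by (auto simp: numeral_eq_enat field_simps)
  have one: "cos (pi / real n) \<noteq> 1" if "2 \<le> enat n" for n
    using cos_monotone_0_pi[of 0 "pi / real n"] *[OF that] by auto
  have "pi / real i = pi / real j" if "2 \<le> enat i" "2 \<le> enat j" "cos (pi / real i) = cos (pi / real j)" for i j
    using cos_inj_pi[of "pi / real i" "pi / real j"] *[of i] *[of j] that by auto
  moreover have "i = j" if "2 \<le> enat i" "2 \<le> enat j" "pi / real i = pi / real j" for i j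
    using that by (auto simp: numeral_eq_enat field_simps)
  ultimately show ?thesis
    using assms one by (cases k; cases l) (auto simp: angle_cos_def dest: sym)
qed

text \<open>If \<open>g\<close> maps two simple roots of \<open>X\<close> into the plane of
  \<open>s\<close> and \<open>t\<close>, their images are \<alpha> s and \<alpha> t, and the braid
  relation is copied to the output. Otherwise at most one simple root of \<open>X\<close> is mapped
  to an inversion, and both sides write the same word of length at most 1.\<close>

lemma equiv_runs_braid:
  assumes X: "X \<subseteq> S" and g: "state X g" and st: "s \<in> S" "t \<in> S" "s \<noteq> t" and k: "m s t = enat k"
  shows "equiv_runs X g (alt_word s t k) (alt_word t s k)"
proof (cases "\<exists>x\<in>X. \<exists>y\<in>X. x \<noteq> y \<and> in_plane s t (g (\<alpha> x)) \<and> in_plane s t (g (\<alpha> y))")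
  case True
  then obtain x y where xy: "x \<in> X" "y \<in> X" "x \<noteq> y"
      "in_plane s t (g (\<alpha> x))" "in_plane s t (g (\<alpha> y))"
    by blast
  have 1: "g (\<alpha> x) = \<alpha> s \<or> g (\<alpha> y) = \<alpha> s"
    using two_in_plane_simple X g st xy by blast
  have 2: "g (\<alpha> x) = \<alpha> t \<or> g (\<alpha> y) = \<alpha> t"
    using two_in_plane_simple[OF X g st(2,1) st(3)[symmetric] xy(1-3)] xy in_plane_sym by blast
  have "\<alpha> s \<noteq> \<alpha> t" using st by simp
  then obtain x y where xy: "x \<in> X" "y \<in> X" "x \<noteq> y" "g (\<alpha> x) = \<alpha> s" "g (\<alpha> y) = \<alpha> t"
    using 1 2 xy(1-3) by metis
  obtain w where w: "w \<in> lists S" "g = act w" using g by (auto simp: state_def)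
  have xyS: "x \<in> S" "y \<in> S" using xy X by auto
  \<comment> \<open>Invariance of the form under \<open>g\<close> shows that \<open>x\<close> and
    \<open>y\<close> carry the same label as \<open>s\<close> and \<open>t\<close>.\<close>
  have "gram x y = gram s t"
    using form_act[OF w(1), of "\<alpha> x" "\<alpha> y"] xy xyS st w(2)
    by (simp add: form_simple_root_left pairing_simple_root)
  then have "angle_cos (m x y) = angle_cos (m s t)"
    using xy st by (simp add: gram_def)
  then have "m x y = enat k"
    using angle_cos_inject[OF m_ge_2[OF xyS xy(3)] m_ge_2[OF st]] k by simp
  then show ?thesis
    using run_alt_word_loops[OF g xy(1,2,4,5)] run_alt_word_loops[OF g xy(2,1,5,4)]
      braid_cong[of x y k] xy xyS by (simp add: equiv_runs_def)
next
  case False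
  let ?u = "alts k s t" and ?v = "alts k t s"
  have lists: "?u \<in> lists S" "?v \<in> lists S" using alts_lists[of s S t] alts_lists[of t S s] st by blast+
  have inv: "inversions ?v = inversions ?u" using inversions_alts_sym[OF st k] by simp
  \<comment> \<open>Both reversed words invert the same map; its surjectivity turns this into an
    equality of functions.\<close>
  have "act (rev ?v) (act ?v v) = act (rev ?u) (act ?v v)" for v
    using act_rev[OF lists(1), of v] act_rev[OF lists(2), of v] act_alts_braid[OF st k] by simp
  moreover have "\<exists>v. z = act ?v v" for z
    using act_rev[of "rev ?v" z] lists by (intro exI[of _ "act (rev ?v) z"]) (auto simp: in_lists_conv_set)
  ultimately have rev: "act (rev ?v) = act (rev ?u)" by (metis ext)
  show ?thesis
  proof (cases "\<exists>x\<in>X. g (\<alpha> x) \<in> inversions ?u")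
    case no: False
    then show ?thesis
      unfolding equiv_runs_def alt_word_eq
      using run_avoiding_inversions[of ?u X g] run_avoiding_inversions[of ?v X g] lists inv rev
      by (auto intro: pres_cong.refl)
  next
    case True
    then obtain x where x: "x \<in> X" "g (\<alpha> x) \<in> inversions ?u" by blast
    have plane: "y = x" if "y \<in> X" "in_plane s t (g (\<alpha> y))" for y
      using False x that inversions_in_plane[OF st x(2)] by blast
    have other: "g (\<alpha> y) \<notin> inversions ?u" if "y \<in> X" "y \<noteq> x" for y
      using plane inversions_in_plane[OF st] that by blast
    obtain w where w: "w \<in> lists S" "g = act w" using g by (auto simp: state_def)
    \<comment> \<open>Adding back a multiple of \<open>g (\<alpha> x)\<close> puts
      \<open>g (\<alpha> y)\<close> into the plane, so \<open>y = x\<close>. Then the vector is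
      minus a nonnegative one, while inversions here are nonnegative, and
      \<open>g (\<alpha> x)\<close> would vanish.\<close>
    have twisted: "g (reflect x (\<alpha> y)) \<notin> inversions ?u" if y: "y \<in> X" for y
    proof
      assume *: "g (reflect x (\<alpha> y)) \<in> inversions ?u"
      then have "in_plane s t (g (reflect x (\<alpha> y)))" using inversions_in_plane[OF st] by blast
      then have "in_plane s t (\<lambda>i. 1 * g (reflect x (\<alpha> y)) i + (2 * pairing x (\<alpha> y)) * g (\<alpha> x) i)"
        using inversions_in_plane[OF st x(2)] by (rule in_plane_lincomb)
      moreover have "(\<lambda>i. 1 * g (reflect x (\<alpha> y)) i + (2 * pairing x (\<alpha> y)) * g (\<alpha> x) i) = g (\<alpha> y)"
        unfolding reflect_altdef w(2) act_lincomb by simp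
      ultimately have "y = x" using plane y by simp
      have "x \<in> S" using x X by blast
      then have neg: "g (reflect x (\<alpha> y)) = (\<lambda>i. - g (\<alpha> x) i)"
        using act_scale[of w "- 1" "\<alpha> x"] w(2) \<open>y = x\<close> by (simp add: reflect_simple_root_self)
      obtain j where j: "j < k" "g (reflect x (\<alpha> y)) = dihedral_root j s t"
        using * inversions_alts[OF st] by auto
      have m2: "2 \<le> m s t" using m_ge_2 st by blast
      have "0 \<le> dihedral_root j s t i" for i
        using cheb_nonneg[OF m2] j(1) k by (simp add: simple_root_def)
      moreover have "0 \<le> g (\<alpha> x) i" for i using g x by (simp add: state_def)
      ultimately have "g (\<alpha> x) i = 0" for i
        using neg j(2) by (metis neg_0_le_iff_le order_antisym)
      then have "g (\<alpha> x) = g (\<lambda>i. 0 * \<alpha> x i)"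
        unfolding w(2) act_scale by auto
      then have "\<alpha> x = (\<lambda>i. 0 * \<alpha> x i)"
        using state_inject[OF g] by blast
      from fun_cong[OF this, of x] show False by simp
    qed
    have "run X g (positive_word ?u) = ([(x, True)], act (rev ?u) \<circ> g \<circ> reflect x)"
      using run_through_one_inversion[OF X g lists(1) x other twisted] .
    moreover have "run X g (positive_word ?v) = ([(x, True)], act (rev ?v) \<circ> g \<circ> reflect x)"
      using run_through_one_inversion[OF X g lists(2) x(1)] x(2) other twisted inv by simp
    ultimately show ?thesis
      using x X rev by (auto simp: equiv_runs_def alt_word_eq intro!: pres_cong.refl)
  qed
qed

lemma equiv_runs:
  assumes "X \<subseteq> S" "(u, v) \<in> pres_cong S R" "state X g"
  shows "equiv_runs X g u v"
  using assms(2,3)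
proof (induction rule: pres_cong.induct)
  case (refl w)
  have "gwords X \<subseteq> gwords S" using assms(1) unfolding gwords_def by (intro lists_mono) auto
  then show ?case
    using run_state[OF assms(1) refl(2,1)] by (auto simp: equiv_runs_def intro: pres_cong.refl)
next
  case (sym v w)
  then show ?case by (auto simp: equiv_runs_def intro: pres_cong.sym)
next
  case (trans u v w)
  then show ?case by (auto simp: equiv_runs_def intro: pres_cong.trans)
next
  case (cancel u v s e)
  then show ?case
    using equiv_runs_context[of X g u v "[(s, e), (s, \<not> e)]" "[]"] equiv_runs_cancel assms(1) by auto
next
  case (rel u v l r)
  have "equiv_runs X h l r" if "state X h" for h
    using rel_cases[OF rel(5)] equiv_runs_involution equiv_runs_braid assms(1) that by blast
  then show ?case using equiv_runs_context rel assms(1) by blast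
qed

section \<open>The retraction on words\<close>

definition retract :: "'a set \<Rightarrow> 'a gword \<Rightarrow> 'a gword" where
  "retract X w = fst (run X id w)"

lemma retract_cong: "X \<subseteq> S \<Longrightarrow> (u, v) \<in> pres_cong S R \<Longrightarrow> (retract X u, retract X v) \<in> pres_cong S R"
  using equiv_runs state_id by (auto simp: retract_def equiv_runs_def)

text \<open>From the identity state every letter of \<open>X\<close> is written as itself and the
  state stays the identity.\<close>

lemma retract_append: "u \<in> gwords X \<Longrightarrow> retract X (u @ v) = u @ retract X v"
proof -
  assume "u \<in> gwords X"
  then have "run X id (u @ v) = apfst ((@) u) (run X id v)"
  proof (induction u)
    case (Cons l u)
    then show ?case
      using run_loop[OF state_id, of "fst l" X "fst l" "snd l" "u @ v"]
      by (simp add: apfst_def map_prod_def split: prod.splits)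
  qed (simp add: apfst_def map_prod_def)
  then show ?thesis by (simp add: retract_def)
qed

lemma retract_self: "u \<in> gwords X \<Longrightarrow> retract X u = u"
  using retract_append[of u X "[]"] by (simp add: retract_def)

text \<open>States reached by reading letters of \<open>K\<close> are products of reflections in
  \<open>K\<close> and keep every coordinate outside \<open>K\<close>. So a letter \<open>x\<close>
  outside \<open>K\<close> could only be written on reading \<open>x\<close> itself.\<close>

lemma retract_gwords:
  assumes "X \<subseteq> S" "K \<subseteq> S" "v \<in> gwords K" shows "retract X v \<in> gwords (X \<inter> K)"
proof -
  have "fst (run X (act w) v) \<in> gwords (X \<inter> K)"
    if "v \<in> gwords K" "w \<in> lists K" "state X (act w)" for v w
    using that
  proof (induction v arbitrary: w)
    case (Cons l v)
    obtain s e where l: "l = (s, e)" by (cases l)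
    have s: "s \<in> K" using Cons l by simp
    show ?case
    proof (cases "\<exists>x\<in>X. act w (\<alpha> x) = \<alpha> s")
      case True
      then obtain x where x: "x \<in> X" "act w (\<alpha> x) = \<alpha> s" by blast
      have "x \<in> K"
      proof (rule ccontr)
        assume "x \<notin> K"
        then have "act w (\<alpha> x) x = 1" using act_outside[of x w "\<alpha> x"] Cons.prems
          by (auto simp: simple_root_def)
        then have "s = x" using x by (simp add: simple_root_def split: if_splits)
        then show False using s \<open>x \<notin> K\<close> by simp
      qed
      then show ?thesis
        using Cons l x run_loop[of X "act w" x s e v] by simp
    next
      case False
      have "state X (act (s # w))"
        using state_step[OF assms(1), of "act w" s] False Cons.prems s assms(2) by auto
      then have "fst (run X (act (s # w)) v) \<in> gwords (X \<inter> K)"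
        using Cons.prems s by (intro Cons.IH) (auto simp: comp_def)
      then show ?thesis using l False by simp
    qed
  qed simp
  from this[of v "[]"] show ?thesis using assms state_id by (simp add: retract_def)
qed

end

section \<open>Subgroups with equivariant retractions\<close>

text \<open>All three assertions follow from these axioms. Equivariance is required for left
  multiplication only; \<rho> need not be a homomorphism.\<close>

locale retractable_subgroups = group G for G (structure) +
  fixes S :: "'i set" and H :: "'i set \<Rightarrow> 'a set" and \<rho> :: "'i set \<Rightarrow> 'a \<Rightarrow> 'a"
  assumes subgroup_H: "J \<subseteq> S \<Longrightarrow> subgroup (H J) G"
    and H_mono: "J \<subseteq> K \<Longrightarrow> K \<subseteq> S \<Longrightarrow> H J \<subseteq> H K"
    and \<rho>_mult: "J \<subseteq> S \<Longrightarrow> h \<in> H J \<Longrightarrow> g \<in> carrier G \<Longrightarrow> \<rho> J (h \<otimes> g) = h \<otimes> \<rho> J g"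
    and \<rho>_self: "J \<subseteq> S \<Longrightarrow> h \<in> H J \<Longrightarrow> \<rho> J h = h"
    and \<rho>_in: "J \<subseteq> S \<Longrightarrow> K \<subseteq> S \<Longrightarrow> k \<in> H K \<Longrightarrow> \<rho> J k \<in> H (J \<inter> K)"
begin

lemma H_carrier: "J \<subseteq> S \<Longrightarrow> h \<in> H J \<Longrightarrow> h \<in> carrier G"
  using subgroup.mem_carrier[OF subgroup_H] .

lemma \<rho>_in':
  assumes "J \<subseteq> S" "K \<subseteq> S" "k \<in> H K"
  shows "\<rho> J k \<in> H J" "\<rho> J k \<in> H K" "\<rho> J k \<in> carrier G"
proof -
  show "\<rho> J k \<in> H J" "\<rho> J k \<in> H K"
    using \<rho>_in[OF assms] H_mono[of "J \<inter> K"] assms by auto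
  then show "\<rho> J k \<in> carrier G" using H_carrier assms by blast
qed

lemma H_Int: "J \<subseteq> S \<Longrightarrow> K \<subseteq> S \<Longrightarrow> H J \<inter> H K = H (J \<inter> K)"
proof
  assume JK: "J \<subseteq> S" "K \<subseteq> S"
  show "H J \<inter> H K \<subseteq> H (J \<inter> K)"
    using \<rho>_self[OF JK(1)] \<rho>_in[OF JK] by (metis IntE subsetI)
  show "H (J \<inter> K) \<subseteq> H J \<inter> H K"
    using H_mono[of "J \<inter> K"] JK by auto
qed

text \<open>Applying the retraction onto \<open>H J\<close> to the right factors of
  \<open>j \<otimes> k = j' \<otimes> l\<close> gives \<open>j \<otimes> u = j' \<otimes> v\<close>,
  where \<open>u\<close> lies also in \<open>H K\<close> and \<open>v\<close> also in
  \<open>H L\<close>.\<close>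

lemma H_mult_Int:
  assumes "J \<subseteq> S" "K \<subseteq> S" "L \<subseteq> S"
  shows "(H J <#> H K) \<inter> (H J <#> H L) = H J <#> (H K \<inter> H L)"
proof
  show "(H J <#> H K) \<inter> (H J <#> H L) \<subseteq> H J <#> (H K \<inter> H L)"
  proof
    fix x assume "x \<in> (H J <#> H K) \<inter> (H J <#> H L)"
    then have "x \<in> H J <#> H K" "x \<in> H J <#> H L" by auto
    then obtain j k j' l where x: "x = j \<otimes> k" "x = j' \<otimes> l"
      and mem: "j \<in> H J" "j' \<in> H J" "k \<in> H K" "l \<in> H L"
      unfolding set_mult_def by blast
    have c: "j \<in> carrier G" "j' \<in> carrier G" "k \<in> carrier G" "l \<in> carrier G"
      using mem H_carrier assms by blast+
    define u v where "u = \<rho> J k" and "v = \<rho> J l"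
    have u: "u \<in> H J" "u \<in> H K" "u \<in> carrier G" and v: "v \<in> H J" "v \<in> H L" "v \<in> carrier G"
      unfolding u_def v_def using \<rho>_in'[OF assms(1,2) mem(3)] \<rho>_in'[OF assms(1,3) mem(4)] by auto
    have uv: "j \<otimes> u = j' \<otimes> v"
      using \<rho>_mult[of J j k] \<rho>_mult[of J j' l] x mem c assms by (simp add: u_def v_def)
    \<comment> \<open>The parts \<open>u\<close> and \<open>v\<close> move into the left factors,
      which then agree and cancel, so the right factors lie in both subgroups.\<close>
    have xu: "x = (j \<otimes> u) \<otimes> (inv u \<otimes> k)"
      using x c u by (simp add: m_assoc) (simp add: m_assoc[symmetric])
    have xv: "x = (j' \<otimes> v) \<otimes> (inv v \<otimes> l)"
      using x(2) c v by (simp add: m_assoc) (simp add: m_assoc[symmetric])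
    have "inv u \<otimes> k = inv v \<otimes> l"
      using xu xv unfolding uv using c u v by simp
    moreover have "inv u \<otimes> k \<in> H K" "inv v \<otimes> l \<in> H L" "j \<otimes> u \<in> H J"
      using mem u v subgroup_H assms by (simp_all add: subgroup.m_closed subgroup.m_inv_closed)
    ultimately show "x \<in> H J <#> (H K \<inter> H L)"
      using xu by (auto simp: set_mult_def)
  qed
qed (auto simp: set_mult_def)

section \<open>Helly property of cosets and the flag condition\<close>

definition cosets :: "'a set set" where
  "cosets = {x <# H J | x J. x \<in> carrier G \<and> J \<subseteq> S}"

lemma cosetsI: "x \<in> carrier G \<Longrightarrow> J \<subseteq> S \<Longrightarrow> x <# H J \<in> cosets"
  by (auto simp: cosets_def)

lemma coset_repr: "J \<subseteq> S \<Longrightarrow> a \<in> carrier G \<Longrightarrow> x \<in> a <# H J \<Longrightarrow> x \<in> carrier G \<and> a <# H J = x <# H J"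
  using l_repr_independence[of x a "H J"] subgroup_H[of J] l_coset_subset_G[of "H J" a]
    subgroup.subset[of "H J" G] by auto

lemma cosets_repr:
  assumes "A \<in> cosets" "x \<in> A"
  obtains J where "x \<in> carrier G" "J \<subseteq> S" "A = x <# H J"
proof -
  obtain a J where "a \<in> carrier G" "J \<subseteq> S" "A = a <# H J"
    using assms(1) by (auto simp: cosets_def)
  then show ?thesis using coset_repr[of J a x] assms(2) that[of J] by simp
qed

lemma coset_Int:
  assumes "A \<in> cosets" "B \<in> cosets" "A \<inter> B \<noteq> {}" shows "A \<inter> B \<in> cosets"
proof -
  obtain x where x: "x \<in> A" "x \<in> B" using assms by blast
  obtain J where J: "J \<subseteq> S" "A = x <# H J" and xG: "x \<in> carrier G"
    using cosets_repr[OF assms(1) x(1)] .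
  obtain K where K: "K \<subseteq> S" "B = x <# H K"
    using cosets_repr[OF assms(2) x(2)] .
  have "A \<inter> B = x <# (H J \<inter> H K)"
    unfolding J K l_coset_def using xG J(1) K(1) H_carrier by auto
  also have "\<dots> = x <# H (J \<inter> K)"
    using H_Int[OF J(1) K(1)] by simp
  also have "\<dots> \<in> cosets"
    using J(1) xG by (intro cosetsI) auto
  finally show ?thesis .
qed

text \<open>Walking around the triangle of pairwise common points gives
  \<open>k = j \<otimes> l\<close>. Retracting onto \<open>H J\<close> turns the corner
  \<open>z\<close> into a point of all three cosets.\<close>

lemma three_cosets_meet:
  assumes "A \<in> cosets" "B \<in> cosets" "C \<in> cosets"
    and "A \<inter> B \<noteq> {}" "A \<inter> C \<noteq> {}" "B \<inter> C \<noteq> {}"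
  shows "A \<inter> B \<inter> C \<noteq> {}"
proof -
  obtain x y z where x: "x \<in> A" "x \<in> B" and y: "y \<in> A" "y \<in> C" and z: "z \<in> B" "z \<in> C"
    using assms by blast
  obtain J where J: "J \<subseteq> S" "A = x <# H J" and xG: "x \<in> carrier G"
    using cosets_repr[OF assms(1) x(1)] .
  obtain K where K: "K \<subseteq> S" "B = x <# H K"
    using cosets_repr[OF assms(2) x(2)] .
  obtain L where L: "L \<subseteq> S" "C = y <# H L" and yG: "y \<in> carrier G"
    using cosets_repr[OF assms(3) y(2)] .
  obtain j k l where j: "j \<in> H J" "y = x \<otimes> j" and k: "k \<in> H K" "z = x \<otimes> k"
      and l: "l \<in> H L" "z = y \<otimes> l"
    using J K L y z by (auto simp: l_coset_def)
  have c: "j \<in> carrier G" "k \<in> carrier G" "l \<in> carrier G"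
    using H_carrier J K L j k l by blast+
  have "x \<otimes> k = x \<otimes> (j \<otimes> l)" using j k l c xG by (simp add: m_assoc)
  then have "k = j \<otimes> l" using c xG by simp
  then have "\<rho> J k = j \<otimes> \<rho> J l" using \<rho>_mult J(1) j c by simp
  moreover have \<rho>: "\<rho> J k \<in> H J" "\<rho> J k \<in> H K" "\<rho> J l \<in> H L" "\<rho> J l \<in> carrier G"
    using \<rho>_in'[OF J(1) K(1) k(1)] \<rho>_in'[OF J(1) L(1) l(1)] by auto
  ultimately have "x \<otimes> \<rho> J k = y \<otimes> \<rho> J l"
    using j c xG by (simp add: m_assoc)
  moreover have "x \<otimes> \<rho> J k \<in> A" "x \<otimes> \<rho> J k \<in> B" "y \<otimes> \<rho> J l \<in> C"
    using J(2) K(2) L(2) \<rho> by (auto simp: l_coset_def)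
  ultimately show ?thesis by auto
qed

text \<open>The induction absorbs \<open>B\<close> into \<open>A\<close>: the intersection is a
  coset by \<open>coset_Int\<close> and still meets each remaining member by
  \<open>three_cosets_meet\<close>.\<close>

lemma cosets_Helly:
  assumes "finite F" "F \<subseteq> cosets" "A \<in> cosets" "\<And>B. B \<in> F \<Longrightarrow> A \<inter> B \<noteq> {}"
    and "\<And>B C. B \<in> F \<Longrightarrow> C \<in> F \<Longrightarrow> B \<inter> C \<noteq> {}"
  shows "A \<inter> \<Inter>F \<noteq> {}"
  using assms
proof (induction F arbitrary: A rule: finite_induct)
  case empty
  then obtain x J where "A = x <# H J" "J \<subseteq> S" by (auto simp: cosets_def)
  then show ?case using subgroup.one_closed[OF subgroup_H] by (auto simp: l_coset_def)
next
  case (insert B F)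
  have "A \<inter> B \<inter> C \<noteq> {}" if "C \<in> F" for C
    using insert.prems that by (intro three_cosets_meet) auto
  moreover have "A \<inter> B \<in> cosets"
    using insert.prems by (intro coset_Int) auto
  ultimately have "(A \<inter> B) \<inter> \<Inter>F \<noteq> {}"
    using insert.prems by (intro insert.IH) auto
  then show ?case by auto
qed

lemma flag_coset_complex:
  assumes "finite I" "\<And>i. i \<in> I \<Longrightarrow> J i \<subseteq> S"
  shows "flag_complex (coset_complex G I (\<lambda>i. H (J i)))" (is "flag_complex ?K")
  unfolding flag_complex_def
proof (intro conjI allI impI)
  show "simplicial_complex ?K"
    unfolding simplicial_complex_def
  proof (intro ballI conjI allI impI)
    fix \<sigma> assume \<sigma>: "\<sigma> \<in> ?K"
    then show "finite \<sigma>" "\<sigma> \<noteq> {}" by (auto simp: coset_complex_def)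
    fix \<tau> assume \<tau>: "\<tau> \<subseteq> \<sigma> \<and> \<tau> \<noteq> {}"
    then have "(\<Inter>v\<in>\<sigma>. snd v) \<subseteq> (\<Inter>v\<in>\<tau>. snd v)" by blast
    with \<sigma> \<tau> show "\<tau> \<in> ?K"
      unfolding coset_complex_def by (auto intro: finite_subset simp del: INT_iff INT_simps)
  qed
next
  fix \<sigma> assume \<sigma>: "\<sigma> \<subseteq> \<Union>?K \<and> \<sigma> \<noteq> {} \<and> (\<forall>v\<in>\<sigma>. \<forall>w\<in>\<sigma>. v \<noteq> w \<longrightarrow> {v, w} \<in> ?K)"
  have vert: "\<sigma> \<subseteq> coset_vertices G I (\<lambda>i. H (J i))"
    using \<sigma> by (auto simp: coset_complex_def)
  have vertD: "\<exists>g\<in>carrier G. fst v \<in> I \<and> snd v = g <# H (J (fst v))" if v: "v \<in> \<sigma>" for v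
  proof -
    obtain i g where "v = (i, g <# H (J i))" "i \<in> I" "g \<in> carrier G"
      using v vert unfolding coset_vertices_def by blast
    then show ?thesis by auto
  qed
  have cosets: "snd ` \<sigma> \<subseteq> cosets"
    using vertD assms(2) unfolding cosets_def by fastforce
  have ne: "A \<noteq> {}" if "A \<in> cosets" for A
    using cosets_Helly[of "{}" A] that by auto
  have meet: "snd v \<inter> snd w \<noteq> {}" if "v \<in> \<sigma>" "w \<in> \<sigma>" for v w
  proof (cases "v = w")
    case True
    then show ?thesis using ne cosets that by auto
  next
    case False
    then have "{v, w} \<in> ?K" using \<sigma> that by blast
    then show ?thesis by (simp add: coset_complex_def)
  qed
  \<comment> \<open>A candidate simplex is not assumed finite. Two vertices of the same type that
    meet are the same coset, so there are at most as many vertices as types.\<close>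
  have "inj_on fst \<sigma>"
  proof (rule inj_onI)
    fix v w assume vw: "v \<in> \<sigma>" "w \<in> \<sigma>" "fst v = fst w"
    obtain g h where gh: "g \<in> carrier G" "h \<in> carrier G" "fst v \<in> I"
        "snd v = g <# H (J (fst v))" "snd w = h <# H (J (fst v))"
      using vertD[OF vw(1)] vertD[OF vw(2)] vw(3) by metis
    obtain x where "x \<in> snd v" "x \<in> snd w" using meet vw by blast
    then have "snd v = snd w"
      using coset_repr[of "J (fst v)"] gh assms(2) by metis
    then show "v = w" using vw(3) by (simp add: prod_eq_iff)
  qed
  moreover have "finite (fst ` \<sigma>)"
    using vertD by (intro finite_subset[OF _ assms(1)]) auto
  ultimately have fin: "finite \<sigma>" using finite_image_iff by blast
  obtain v where "v \<in> \<sigma>" using \<sigma> by blast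
  then have "snd v \<inter> \<Inter>(snd ` \<sigma>) \<noteq> {}"
    using fin cosets meet meet[OF \<open>v \<in> \<sigma>\<close>] by (intro cosets_Helly) (blast | simp)+
  then show "\<sigma> \<in> ?K"
    using fin \<sigma> vert by (auto simp: coset_complex_def)
qed

end

section \<open>Groups presented by braid relations and involutions\<close>

context braid_presentation
begin

abbreviation G :: "'a gword set monoid" where
  "G \<equiv> presented_group S R"

definition cls :: "'a gword \<Rightarrow> 'a gword set" where
  "cls w = pres_cong S R `` {w}"

lemma gwords_mono: "J \<subseteq> K \<Longrightarrow> gwords J \<subseteq> gwords K"
  unfolding gwords_def by (intro lists_mono) auto

lemma carrier_eq: "carrier G = cls ` gwords S"
  by (auto simp: presented_group_def quotient_def cls_def)

lemma cls_eq_iff: "u \<in> gwords S \<Longrightarrow> v \<in> gwords S \<Longrightarrow> cls u = cls v \<longleftrightarrow> (u, v) \<in> pres_cong S R"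
  unfolding cls_def by (rule eq_equiv_class_iff[OF equiv_pres_cong])

lemma cls_mult: "u \<in> gwords S \<Longrightarrow> v \<in> gwords S \<Longrightarrow> cls u \<otimes>\<^bsub>G\<^esub> cls v = cls (u @ v)"
  unfolding cls_def by (rule presented_group_mult)

lemma one_eq: "\<one>\<^bsub>G\<^esub> = cls []"
  by (simp add: presented_group_def cls_def)

lemma inv_pres_gen:
  assumes "s \<in> S" shows "inv\<^bsub>G\<^esub> (pres_gen S R s) = cls [(s, False)]"
proof -
  interpret group G by (rule group_presented_group)
  have "cls [(s, False)] \<otimes>\<^bsub>G\<^esub> cls [(s, True)] = \<one>\<^bsub>G\<^esub>"
    using pres_cong.cancel[of "[]" S "[]" s False R] assms by (simp add: cls_mult one_eq cls_eq_iff)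
  then show ?thesis
    using assms by (intro inv_equality) (auto simp: carrier_eq pres_gen_def cls_def[symmetric])
qed

lemma generate_pres_gen:
  assumes "J \<subseteq> S"
  shows "generate G (pres_gen S R ` J) = cls ` gwords J"
proof
  have JS: "gwords J \<subseteq> gwords S" using gwords_mono assms by blast
  show "generate G (pres_gen S R ` J) \<subseteq> cls ` gwords J"
  proof
    fix x assume "x \<in> generate G (pres_gen S R ` J)"
    then show "x \<in> cls ` gwords J"
    proof (induction rule: generate.induct)
      case one
      then show ?case by (auto simp: one_eq)
    next
      case (incl h)
      then show ?case by (auto simp: pres_gen_def cls_def)
    next
      case (inv h)
      then obtain s where "s \<in> J" "h = pres_gen S R s" by blast
      then show ?case using inv_pres_gen[of s] assms by auto
    next
      case (eng h1 h2)
      then obtain u v where "u \<in> gwords J" "v \<in> gwords J" "h1 = cls u" "h2 = cls v" by blast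
      moreover from this have "u \<in> gwords S" "v \<in> gwords S" using JS by blast+
      ultimately show ?case by (simp add: cls_mult)
    qed
  qed
  show "cls ` gwords J \<subseteq> generate G (pres_gen S R ` J)"
  proof
    fix x assume "x \<in> cls ` gwords J"
    then obtain w where "w \<in> gwords J" "x = cls w" by blast
    moreover have "cls w \<in> generate G (pres_gen S R ` J)" if "w \<in> gwords J" for w
      using that
    proof (induction w)
      case Nil
      then show ?case using generate.one[of G] by (simp add: one_eq)
    next
      case (Cons l w)
      obtain s e where l: "l = (s, e)" by (cases l)
      have s: "s \<in> J" "s \<in> S" using Cons l assms by auto
      have "cls [(s, e)] \<in> generate G (pres_gen S R ` J)"
      proof (cases e)
        case True
        then show ?thesis
          using generate.incl[of "pres_gen S R s" "pres_gen S R ` J" G] s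
          by (simp add: pres_gen_def cls_def)
      next
        case False
        then show ?thesis
          using generate.inv[of "pres_gen S R s" "pres_gen S R ` J" G] s inv_pres_gen by simp
      qed
      moreover have "cls (l # w) = cls [(s, e)] \<otimes>\<^bsub>G\<^esub> cls w"
        using cls_mult[of "[(s, e)]" w] Cons.prems s JS l by auto
      ultimately show ?case using Cons by (simp add: generate.eng)
    qed
    ultimately show "x \<in> generate G (pres_gen S R ` J)" by blast
  qed
qed

text \<open>Any representative gives the same class, because \<open>retract\<close> respects the
  congruence.\<close>

definition class_retract :: "'a set \<Rightarrow> 'a gword set \<Rightarrow> 'a gword set" where
  "class_retract X A = cls (retract X (SOME w. w \<in> gwords S \<and> cls w = A))"

lemma class_retract:
  assumes "X \<subseteq> S" "w \<in> gwords S" shows "class_retract X (cls w) = cls (retract X w)"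
proof -
  define v where "v = (SOME v. v \<in> gwords S \<and> cls v = cls w)"
  have v: "v \<in> gwords S" "cls v = cls w"
    unfolding v_def using someI[of "\<lambda>v. v \<in> gwords S \<and> cls v = cls w" w] assms by auto
  then have "(retract X v, retract X w) \<in> pres_cong S R"
    using retract_cong[OF assms(1)] cls_eq_iff assms by blast
  then show ?thesis
    unfolding class_retract_def v_def[symmetric] using cls_eq_iff pres_cong_gwords by blast
qed

lemma retractable_subgroups:
  "retractable_subgroups G S (\<lambda>J. generate G (pres_gen S R ` J)) class_retract"
proof -
  interpret group G by (rule group_presented_group)
  show ?thesis
  proof (intro retractable_subgroups.intro retractable_subgroups_axioms.intro)
    show "group G" by (rule group_presented_group)
  next
    fix J assume J: "J \<subseteq> S"
    then have JS: "gwords J \<subseteq> gwords S" by (rule gwords_mono)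
    note gen = generate_pres_gen[OF J]
    have "pres_gen S R ` J \<subseteq> carrier G"
      using J by (auto simp: carrier_eq pres_gen_def cls_def[symmetric])
    then show "subgroup (generate G (pres_gen S R ` J)) G"
      by (rule generate_is_subgroup)
    fix h assume "h \<in> generate G (pres_gen S R ` J)"
    then obtain u where u: "u \<in> gwords J" "u \<in> gwords S" "h = cls u" using gen JS by auto
    show "class_retract J h = h"
      using u J by (simp add: class_retract retract_self)
    fix g assume "g \<in> carrier G"
    then obtain v where v: "v \<in> gwords S" "g = cls v" by (auto simp: carrier_eq)
    have "retract J v \<in> gwords S"
      using retract_gwords[of J S v] gwords_mono[of "J \<inter> S" S] J v by auto
    then show "class_retract J (h \<otimes>\<^bsub>G\<^esub> g) = h \<otimes>\<^bsub>G\<^esub> class_retract J g"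
      using u v J by (simp add: cls_mult class_retract retract_append)
  next
    fix J K :: "'a set" assume "J \<subseteq> K" "K \<subseteq> S"
    then show "generate G (pres_gen S R ` J) \<subseteq> generate G (pres_gen S R ` K)"
      by (intro mono_generate image_mono)
  next
    fix J K :: "'a set" and k assume J: "J \<subseteq> S" and K: "K \<subseteq> S" and "k \<in> generate G (pres_gen S R ` K)"
    then obtain v where v: "v \<in> gwords K" "k = cls v" by (auto simp: generate_pres_gen)
    then have "v \<in> gwords S" using gwords_mono K by blast
    moreover have "J \<inter> K \<subseteq> S" using J by blast
    ultimately show "class_retract J k \<in> generate G (pres_gen S R ` (J \<inter> K))"
      using v retract_gwords[OF J K v(1)] by (simp add: class_retract J generate_pres_gen)
  qed
qed

end

text \<open>The condition \<open>i + j = 1\<close> singles out the edge between 0 and 1. All finite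
  labels at 0 are even, as needed for 0 to be the only involutive generator.\<close>

definition shephard_label :: "nat \<Rightarrow> (nat \<Rightarrow> nat \<Rightarrow> enat) \<Rightarrow> nat \<Rightarrow> nat \<Rightarrow> enat" where
  "shephard_label n p i j =
    (if i = 0 \<or> j = 0 then if i + j = 1 then 2 * p 1 n else 2 else p (min i j) (max i j))"

lemma shephard_braid_presentation:
  assumes n: "n \<ge> 2"
    and p: "\<And>i j. 1 \<le> i \<Longrightarrow> i < j \<Longrightarrow> j \<le> n - 1 \<Longrightarrow> p i j \<ge> 2"
    and p1: "p 1 n \<ge> 2"
  shows "braid_presentation {0..<n} (shephard_label n p) {0} (shephard_rels n p)"
proof
  let ?S = "{0..<n}" and ?m = "shephard_label n p" and ?R = "shephard_rels n p"
  show "finite ?S" "{0} \<subseteq> ?S" using n by auto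
  show sym: "?m s t = ?m t s" for s t
    by (simp add: shephard_label_def min.commute max.commute add.commute)
  have "2 \<le> 2 * p 1 n"
    using p1 by (cases "p 1 n") (auto simp: numeral_eq_enat)
  then show "2 \<le> ?m s t" if "s \<in> ?S" "t \<in> ?S" "s \<noteq> t" for s t
    using that p[of "min s t" "max s t"] by (auto simp: shephard_label_def min_def max_def)
  have double: "2 * q = enat k \<longleftrightarrow> (\<exists>l. k = 2 * l \<and> q = enat l)" for q k
    by (cases q) (auto simp: numeral_eq_enat)
  have label_0: "even k" if "?m 0 t = enat k" "t \<noteq> 0" for t k
    using that double[of "p (Suc 0) n" k]
    by (cases "t = 1") (auto simp: shephard_label_def, simp add: numeral_eq_enat)
  show "s \<in> {0} \<longleftrightarrow> t \<in> {0}" if "s \<noteq> t" "?m s t = enat k" "odd k" for s t k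
    using label_0 sym that by (metis singletonD singletonI)
  have a2: "alt_word s t 2 = [(s, True), (t, True)]" for s t :: nat
    by (simp add: alt_word_def numeral_2_eq_2)
  have mem: "alt_word s t k \<in> gwords ?S" if "s \<in> ?S" "t \<in> ?S" for s t k
    using that by (auto simp: alt_word_def gwords_def)
  show "(\<exists>s\<in>{0}. l = [(s, True), (s, True)] \<and> r = []) \<or>
      (\<exists>s\<in>?S. \<exists>t\<in>?S. \<exists>k. s \<noteq> t \<and> ?m s t = enat k \<and> l = alt_word s t k \<and> r = alt_word t s k)"
    if lr: "(l, r) \<in> ?R" for l r
  proof -
    consider "l = alt_word 0 0 2" "r = []"
      | k where "l = alt_word 0 1 (2 * k)" "r = alt_word 1 0 (2 * k)" "p 1 n = enat k"
      | i where "l = alt_word 0 i 2" "r = alt_word i 0 2" "2 \<le> i" "i \<le> n - 1"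
      | i j k where "l = alt_word i j k" "r = alt_word j i k" "1 \<le> i" "i < j" "j \<le> n - 1" "p i j = enat k"
      using lr unfolding shephard_rels_def by auto
    then show ?thesis
    proof cases
      case 1
      then show ?thesis by (simp add: a2)
    next
      case (2 k)
      then show ?thesis
        using n by (intro disjI2 bexI[of _ 0] bexI[of _ 1] exI[of _ "2 * k"])
          (auto simp: shephard_label_def double)
    next
      case (3 i)
      then show ?thesis
        by (intro disjI2 bexI[of _ 0] bexI[of _ i] exI[of _ 2])
          (auto simp: shephard_label_def numeral_eq_enat)
    next
      case (4 i j k)
      then show ?thesis
        by (intro disjI2 bexI[of _ i] bexI[of _ j] exI[of _ k]) (auto simp: shephard_label_def)
    qed
  qed
  have R: "(l, r) \<in> pres_cong ?S ?R" if "(l, r) \<in> ?R" "l \<in> gwords ?S" "r \<in> gwords ?S" for l r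
    using pres_cong.rel[of "[]" ?S "[]" l r ?R] that by simp
  have "(alt_word 0 0 2, []) \<in> pres_cong ?S ?R"
    using n by (intro R mem) (auto simp: shephard_rels_def)
  then show "([(s, True), (s, True)], []) \<in> pres_cong ?S ?R" if "s \<in> {0}" for s
    using that by (simp add: a2)
  \<comment> \<open>The relations are listed for increasing pairs only; the other order follows by
    symmetry of the congruence.\<close>
  have lt: "(alt_word s t k, alt_word t s k) \<in> pres_cong ?S ?R"
    if "s < t" "t < n" "?m s t = enat k" for s t k
  proof (intro R mem)
    show "(alt_word s t k, alt_word t s k) \<in> ?R"
    proof (cases "s = 0")
      case False
      then have "p s t = enat k" "1 \<le> s" "t \<le> n - 1"
        using that by (auto simp: shephard_label_def)
      then show ?thesis using that unfolding shephard_rels_def by blast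
    next
      case s: True
      show ?thesis
      proof (cases "t = 1")
        case True
        then have "2 * p 1 n = enat k"
          using s that by (simp add: shephard_label_def)
        then obtain l where "k = 2 * l" "p 1 n = enat l"
          using double by blast
        then show ?thesis using s True unfolding shephard_rels_def by blast
      next
        case False
        then have "k = 2" "2 \<le> t" "t \<le> n - 1"
          using s that by (auto simp: shephard_label_def numeral_eq_enat)
        then show ?thesis using s unfolding shephard_rels_def by blast
      qed
    qed
  qed (use that in auto)
  show "(alt_word s t k, alt_word t s k) \<in> pres_cong ?S ?R"
    if "s \<in> ?S" "t \<in> ?S" "s \<noteq> t" "?m s t = enat k" for s t k
    using lt[of s t k] lt[of t s k] that sym[of s t]
    by (cases "s < t") (auto intro: pres_cong.sym)
qed

theorem theorem5p15:
  fixes n :: nat and p :: "nat \<Rightarrow> nat \<Rightarrow> enat"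
  assumes "n \<ge> 2"
    and "\<And>i j. 1 \<le> i \<Longrightarrow> i < j \<Longrightarrow> j \<le> n - 1 \<Longrightarrow> p i j \<ge> 2 \<and> p i j = p j i"
    and "p 1 n \<ge> 2"
  shows "(\<forall>J K L. J \<subseteq> {0..<n} \<and> K \<subseteq> {0..<n} \<and> L \<subseteq> {0..<n} \<longrightarrow>
           shephard_sub n p J \<inter> shephard_sub n p K = shephard_sub n p (J \<inter> K) \<and>
           (shephard_sub n p J <#>\<^bsub>shephard_group n p\<^esub> shephard_sub n p K) \<inter>
           (shephard_sub n p J <#>\<^bsub>shephard_group n p\<^esub> shephard_sub n p L) =
           shephard_sub n p J <#>\<^bsub>shephard_group n p\<^esub> (shephard_sub n p K \<inter> shephard_sub n p L)) \<and>
         flag_complex (coset_complex (shephard_group n p) {0..<n}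
           (\<lambda>i. shephard_sub n p ({0..<n} - {i})))"
proof -
  interpret braid_presentation "{0..<n}" "shephard_label n p" "{0}" "shephard_rels n p"
    using assms by (intro shephard_braid_presentation) auto
  have sub: "shephard_sub n p J = generate (shephard_group n p) (pres_gen {0..<n} (shephard_rels n p) ` J)" for J
    by (simp add: shephard_sub_def shephard_gen_def[abs_def])
  interpret retractable_subgroups "shephard_group n p" "{0..<n}" "shephard_sub n p" class_retract
    using retractable_subgroups by (simp add: sub[abs_def] shephard_group_def)
  show ?thesis
    using H_Int H_mult_Int flag_coset_complex[of "{0..<n}" "\<lambda>i. {0..<n} - {i}"] by auto
qed

end
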